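(* Let $\Bbbk$ be a field, let $A$ be a monomial algebra over $\Bbbk$, and let $(\Delta_n)_{n\geqslant 2}$ be the $A_\infty$-coalgebra structure on $\mathrm{Tor}_A=\mathrm{Tor}_A(\Bbbk,\Bbbk)$ transferred from the bar construction $BA$ along the contraction $(i,p,h)$ described in the context. Let $\gamma$ be a chain and let $n\geqslant 2$. The terms that appear in $\Delta_n(\gamma)$ are exactly those of the form $\gamma_1\otimes\cdots\otimes\gamma_n$ with $(\gamma_1,\ldots,\gamma_n)$ a decomposition of $\gamma$. Moreover, if $\gamma_i$ is of length $r_i$ for each $i\in\{1,\ldots,n\}$, the coefficient of $\gamma_1\otimes\cdots\otimes\gamma_n$ in $\Delta_n(\gamma)$ is $(-1)^N$, where $$ N=\binom{n+1}{2}+r_1+\sum_{i=1}^{n-1}(n-i)(r_i+1).$$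
   Context: A monomial algebra is a quotient $A=\Bbbk\langle x_1,\ldots,x_k\rangle/(R)$ of a free algebra on finitely many variables by the ideal generated by a finite set $R$ of monomials; $R$ is taken minimal (no element of $R$ divides another) and its elements have length at least $2$. A monomial is normal if no element of $R$ divides it; normal monomials form a basis of $A$ and all other monomials are $0$ in $A$. For nonempty normal monomials $u,v$, "$uv=0$ minimally" means that $uv=0$ in $A$ but $uv'\neq 0$ in $A$ for every proper prefix $v'$ of $v$. Bar construction. $BA$ has basis the bar terms $[a_1|\cdots|a_n]$, $n\geqslant 1$, with each $a_i$ a nonempty normal monomial, in degree $n$, with differential $d[a_1|\cdots|a_n]=\sum_{i=1}^{n-1}(-1)^{i-1}[a_1|\cdots|a_ia_{i+1}|\cdots|a_n]$ (a term is $0$ if $a_ia_{i+1}=0$ in $A$) and coproduct $\Delta_2'[a_1|\cdots|a_n]=\sum_{i=1}^{n-1}[a_1|\cdots|a_i]\otimes[a_{i+1}|\cdots|a_n]$. Chains. For $r\geqslant 0$, an $r$-chain (chain of length $r$) is a bar term $[u_0|u_1|\cdots|u_r]$ with $u_0$ a variable and $u_ju_{j+1}=0$ minimally for $j=0,\ldots,r-1$; it is determined by, and identified with, its underlying monomial $u_0\cdots u_r$. A decomposition of an $r$-chain $\gamma$ is a tuple $(\gamma_1,\ldots,\gamma_n)$, $n\geqslant 2$, of chains of lengths $r_1,\ldots,r_n$ with $r_1+\cdots+r_n=r-1$ whose concatenation, in this order, is the monomial $\gamma$. The contraction. Let $G$ be the weighted directed graph with vertices the bar terms and an edge $c\to c'$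 of weight $[c:c']$ whenever $c'$ appears in $dc$ with coefficient $[c:c']\neq 0$. Let $M$ be the set of edges $[u_0|u_1|\cdots|u_{j-1}|u_j|\cdots]\to[u_0|u_1|\cdots|u_{j-1}u_j|\cdots]$, $j\geqslant 1$, with $u_0$ a variable, $u_0u_1=u_1u_2=\cdots=u_{j-2}u_{j-1}=0$ minimally, and $u_{j-1}u_j\neq 0$. Let $G_M$ be $G$ with each edge $c\to c'$ of $M$ replaced by the inverted edge $c'\to c$ of weight $-[c:c']^{-1}$. The critical vertices (those in no edge of $M$) are exactly the chains. Let $\Theta(c,c')$ be the sum over all directed paths in $G_M$ from $c$ to $c'$ of the product of the weights of the edges (the empty path has weight $1$). The chains form a basis of (the positive-degree part of) $\mathrm{Tor}_A$, an $r$-chain being in degree $r+1$; $i:\mathrm{Tor}_A\to BA$ is the inclusion of the span of the chains, $p(c)=\sum_{c'}\Theta(c,c')c'$ over chains $c'$ of the same degree as $c$, and $h(c)=\sum_{c'}\Theta(c,c')c'$ over bar terms $c'$ of degree one more than $c$. One has $pi=1$, $ip-1=dh+hd$, $h^2=0$, $hi=0$, $ph=0$. Transferred structure. Put $\Delta_n'=\sum_{s+t=n,\ s,t>0}(-1)^{s(t+1)}(\Delta_s'h\otimes\Delta_t'h)\Delta_2'$ for $n\geqslant 3$, with the convention $\Delta_1'h=1$, and $\Delta_n=p^{\otimes n}\Delta_n'i:\mathrm{Tor}_A\to\mathrm{Tor}_A^{\otimes n}$ for $n\geqslant 2$ (and $\Delta_1=0$). The Koszul sign rule is used: $(f\otimes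 g)(x\otimes y)=(-1)^{|g||x|}f(x)\otimes g(y)$. *)

theory Defs
  imports Complex_Main "HOL-Library.Poly_Mapping" "HOL-Library.Sublist"
begin

section \<open>Free vector spaces and tensor words\<close>

text \<open>The vector space with basis \<^typ>\<open>'b\<close> is \<^typ>\<open>'b \<Rightarrow>\<^sub>0 'k\<close>.\<close>

definition scale :: "'k::field \<Rightarrow> ('b \<Rightarrow>\<^sub>0 'k) \<Rightarrow> ('b \<Rightarrow>\<^sub>0 'k)" where
  "scale a x = Poly_Mapping.map ((*) a) x"

definition lin :: "('b \<Rightarrow> ('c \<Rightarrow>\<^sub>0 'k)) \<Rightarrow> ('b \<Rightarrow>\<^sub>0 'k) \<Rightarrow> ('c \<Rightarrow>\<^sub>0 'k::field)" where
  "lin f x = (\<Sum>b\<in>Poly_Mapping.keys x. scale (Poly_Mapping.lookup x b) (f b))"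

text \<open>Bilinear extension of list concatenation.  On words over the alphabet this is the product
  of the free algebra.  The basis of the \<open>n\<close>-th tensor power of a space with basis \<^typ>\<open>'b\<close> consists
  of the lists over \<^typ>\<open>'b\<close> of length \<open>n\<close>, and there it is \<open>(x, y) \<mapsto> x \<otimes> y\<close>.\<close>

definition tens :: "('b list \<Rightarrow>\<^sub>0 'k) \<Rightarrow> ('b list \<Rightarrow>\<^sub>0 'k) \<Rightarrow> ('b list \<Rightarrow>\<^sub>0 'k::field)" where
  "tens x y = lin (\<lambda>u. lin (\<lambda>v. Poly_Mapping.single (u @ v) 1) y) x"

primrec tensor_power :: "('b \<Rightarrow> ('c \<Rightarrow>\<^sub>0 'k)) \<Rightarrow> 'b list \<Rightarrow> ('c list \<Rightarrow>\<^sub>0 'k::field)" where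
  "tensor_power f [] = Poly_Mapping.single [] 1"
| "tensor_power f (c # cs) = tens (lin (\<lambda>a. Poly_Mapping.single [a] 1) (f c)) (tensor_power f cs)"


section \<open>Monomial algebras\<close>

text \<open>The variables are the elements of a finite type \<^typ>\<open>'x\<close>, and monomials are lists of variables.\<close>

definition monomial_relations :: "'x::finite list set \<Rightarrow> bool" where
  "monomial_relations R \<longleftrightarrow>
     finite R \<and> (\<forall>r\<in>R. length r \<ge> 2) \<and> (\<forall>r\<in>R. \<forall>r'\<in>R. sublist r r' \<longrightarrow> r = r')"

definition normal :: "'x list set \<Rightarrow> 'x list \<Rightarrow> bool" where
  "normal R w \<longleftrightarrow> (\<forall>r\<in>R. \<not> sublist r w)"

text \<open>The two-sided ideal of the free algebra generated by \<open>R\<close>.  Lemma \<open>rel_ideal_iff\<close> says that the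
  normal monomials form a basis of the quotient \<open>A\<close> and that all other monomials vanish
  in \<open>A\<close>; so below, for monomials \<open>u\<close> and \<open>v\<close>, \<open>u v = 0\<close> in \<open>A\<close> is expressed as
  \<open>\<not> normal R (u @ v)\<close>, and otherwise \<open>u @ v\<close> is the product in \<open>A\<close>.\<close>

inductive_set rel_ideal :: "'x list set \<Rightarrow> ('x list \<Rightarrow>\<^sub>0 'k::field) set"
  for R :: "'x list set" where
  zero: "0 \<in> rel_ideal R"
| gen: "r \<in> R \<Longrightarrow> Poly_Mapping.single r 1 \<in> rel_ideal R"
| add: "x \<in> rel_ideal R \<Longrightarrow> y \<in> rel_ideal R \<Longrightarrow> x + y \<in> rel_ideal R"
| mult_left: "x \<in> rel_ideal R \<Longrightarrow> tens a x \<in> rel_ideal R"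
| mult_right: "x \<in> rel_ideal R \<Longrightarrow> tens x a \<in> rel_ideal R"

lemma lookup_scale [simp]:
  "Poly_Mapping.lookup (scale a x) b = a * Poly_Mapping.lookup x b"
  by (simp add: scale_def map.rep_eq when_def)

lemma keys_scale: "Poly_Mapping.keys (scale a x) \<subseteq> Poly_Mapping.keys x"
  by (auto simp: in_keys_iff)

lemma scale_single [simp]: "scale a (Poly_Mapping.single b c) = Poly_Mapping.single b (a * c)"
  by (rule poly_mapping_eqI) (simp add: lookup_single when_def)

lemma lin_single [simp]: "lin f (Poly_Mapping.single b c) = scale c (f b)"
  by (cases "c = 0") (auto simp: lin_def intro!: poly_mapping_eqI)

lemma tens_single [simp]:
  "tens (Poly_Mapping.single u a) (Poly_Mapping.single v b) = Poly_Mapping.single (u @ v) (a * b)"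
  by (simp add: tens_def)

lemma keys_lin: "Poly_Mapping.keys (lin f x) \<subseteq> (\<Union>b\<in>Poly_Mapping.keys x. Poly_Mapping.keys (f b))"
  unfolding lin_def by (rule order_trans[OF keys_sum]) (intro UN_mono order_refl keys_scale)

lemma keys_tens:
  fixes x y :: "'a list \<Rightarrow>\<^sub>0 'b::field"
  shows "w \<in> Poly_Mapping.keys (tens x y) \<Longrightarrow>
    \<exists>u\<in>Poly_Mapping.keys x. \<exists>v\<in>Poly_Mapping.keys y. w = u @ v"
proof -
  assume "w \<in> Poly_Mapping.keys (tens x y)"
  then obtain u where u: "u \<in> Poly_Mapping.keys x"
      and w: "w \<in> Poly_Mapping.keys (lin (\<lambda>v. Poly_Mapping.single (u @ v) 1) y)"
    unfolding tens_def by (blast dest: subsetD[OF keys_lin])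
  from subsetD[OF keys_lin w] obtain v where "v \<in> Poly_Mapping.keys y"
      and "w \<in> Poly_Mapping.keys (Poly_Mapping.single (u @ v) (1::'b))"
    by (elim UN_E)
  then show ?thesis using u by auto
qed

lemma not_normal_append:
  assumes "\<not> normal R v"
  shows "\<not> normal R (u @ v)" and "\<not> normal R (v @ u)"
proof -
  obtain r a b where r: "r \<in> R" and v: "v = a @ r @ b"
    using assms by (auto simp: normal_def sublist_def)
  have "u @ v = (u @ a) @ r @ b" "v @ u = a @ r @ (b @ u)" using v by simp_all
  then show "\<not> normal R (u @ v)" "\<not> normal R (v @ u)"
    using r unfolding normal_def sublist_def by blast+
qed

lemma rel_ideal_iff:
  fixes x :: "'x list \<Rightarrow>\<^sub>0 'k::field"
  shows "x \<in> rel_ideal R \<longleftrightarrow> (\<forall>w\<in>Poly_Mapping.keys x. \<not> normal R w)"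
proof
  assume "x \<in> rel_ideal R"
  then show "\<forall>w\<in>Poly_Mapping.keys x. \<not> normal R w"
  proof induction
    case (gen r)
    then show ?case by (auto simp: normal_def)
  next
    case (add x y)
    then show ?case using Poly_Mapping.keys_add[of x y] by blast
  next
    case (mult_left x a)
    then show ?case using keys_tens[of _ a x] not_normal_append(1) by metis
  next
    case (mult_right x a)
    then show ?case using keys_tens[of _ x a] not_normal_append(2) by metis
  qed simp
next
  have mono: "Poly_Mapping.single w c \<in> rel_ideal R" if w: "\<not> normal R w" for w and c :: 'k
  proof -
    obtain r a b where r: "r \<in> R" and w: "w = a @ r @ b"
      using w by (auto simp: normal_def sublist_def)
    have "tens (tens (Poly_Mapping.single a c) (Poly_Mapping.single r 1)) (Poly_Mapping.single b 1)
            \<in> (rel_ideal R :: ('x list \<Rightarrow>\<^sub>0 'k) set)"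
      using r by (intro rel_ideal.intros)
    then show ?thesis by (simp add: w)
  qed
  assume x: "\<forall>w\<in>Poly_Mapping.keys x. \<not> normal R w"
  have sum_in: "(\<Sum>w\<in>F. Poly_Mapping.single w (Poly_Mapping.lookup x w)) \<in> rel_ideal R"
    if "finite F" "F \<subseteq> Poly_Mapping.keys x" for F
    using that by induction (auto intro!: rel_ideal.zero rel_ideal.add mono simp: x)
  have "x = (\<Sum>w\<in>Poly_Mapping.keys x. Poly_Mapping.single w (Poly_Mapping.lookup x w))"
    by (rule poly_mapping_eqI)
       (simp add: lookup_sum lookup_single when_def in_keys_iff)
  then show "x \<in> rel_ideal R" using sum_in[of "Poly_Mapping.keys x"] by simp
qed

definition zero_minimally :: "'x list set \<Rightarrow> 'x list \<Rightarrow> 'x list \<Rightarrow> bool" where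
  "zero_minimally R u v \<longleftrightarrow>
     u \<noteq> [] \<and> v \<noteq> [] \<and> normal R u \<and> normal R v \<and>
     \<not> normal R (u @ v) \<and> (\<forall>v'. strict_prefix v' v \<longrightarrow> normal R (u @ v'))"


section \<open>Bar construction\<close>

definition bar_term :: "'x list set \<Rightarrow> 'x list list \<Rightarrow> bool" where
  "bar_term R c \<longleftrightarrow> c \<noteq> [] \<and> (\<forall>u\<in>set c. u \<noteq> [] \<and> normal R u)"

text \<open>\<open>merge i c\<close> multiplies the entries at the positions \<open>i\<close> and \<open>i + 1\<close>, counted from \<open>0\<close>.\<close>

definition merge :: "nat \<Rightarrow> 'x list list \<Rightarrow> 'x list list" where
  "merge i c = take i c @ [c ! i @ c ! Suc i] @ drop (i + 2) c"

definition bar_d :: "'x list set \<Rightarrow> 'x list list \<Rightarrow> ('x list list \<Rightarrow>\<^sub>0 'k::field)" where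
  "bar_d R c = (\<Sum>i<length c - 1.
     if normal R (c ! i @ c ! Suc i) then Poly_Mapping.single (merge i c) ((-1) ^ i) else 0)"

definition bar_coproduct :: "'x list list \<Rightarrow> ('x list list list \<Rightarrow>\<^sub>0 'k::field)" where
  "bar_coproduct c = (\<Sum>i\<in>{1..<length c}. Poly_Mapping.single [take i c, drop i c] 1)"


section \<open>Chains and decompositions\<close>

definition chain :: "'x list set \<Rightarrow> nat \<Rightarrow> 'x list list \<Rightarrow> bool" where
  "chain R r c \<longleftrightarrow> bar_term R c \<and> length c = r + 1 \<and> length (c ! 0) = 1 \<and>
     (\<forall>j<r. zero_minimally R (c ! j) (c ! Suc j))"

text \<open>For a chain \<open>c\<close>, \<open>concat c\<close> is its underlying monomial.\<close>

definition decomposition :: "'x list set \<Rightarrow> 'x list list \<Rightarrow> 'x list list list \<Rightarrow> bool" where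
  "decomposition R \<gamma> \<gamma>s \<longleftrightarrow> length \<gamma>s \<ge> 2 \<and>
     (\<exists>r rs. chain R r \<gamma> \<and> list_all2 (chain R) rs \<gamma>s \<and> int (sum_list rs) = int r - 1) \<and>
     concat (map concat \<gamma>s) = concat \<gamma>"


section \<open>The contraction\<close>

text \<open>A weighted directed graph is given by its weight function; \<open>(c, c')\<close> is an edge iff its weight
  is nonzero.\<close>

definition G_weight :: "'x list set \<Rightarrow> 'x list list \<Rightarrow> 'x list list \<Rightarrow> 'k::field" where
  "G_weight R c c' = (if bar_term R c then Poly_Mapping.lookup (bar_d R c) c' else 0)"

definition matched :: "'x list set \<Rightarrow> 'x list list \<Rightarrow> 'x list list \<Rightarrow> bool" where
  "matched R c c' \<longleftrightarrow> bar_term R c \<and> length (c ! 0) = 1 \<and>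
     (\<exists>j. 1 \<le> j \<and> j < length c \<and>
        (\<forall>i. Suc i < j \<longrightarrow> zero_minimally R (c ! i) (c ! Suc i)) \<and>
        normal R (c ! (j - 1) @ c ! j) \<and> c' = merge (j - 1) c)"

definition GM_weight :: "'x list set \<Rightarrow> 'x list list \<Rightarrow> 'x list list \<Rightarrow> 'k::field" where
  "GM_weight R c c' =
     (if matched R c c' then 0
      else if matched R c' c then - inverse (G_weight R c' c)
      else G_weight R c c')"

definition paths :: "('v \<Rightarrow> 'v \<Rightarrow> 'k::field) \<Rightarrow> 'v \<Rightarrow> 'v \<Rightarrow> 'v list set" where
  "paths w c c' = {vs. vs \<noteq> [] \<and> hd vs = c \<and> last vs = c' \<and> successively (\<lambda>a b. w a b \<noteq> 0) vs}"

definition path_weight :: "('v \<Rightarrow> 'v \<Rightarrow> 'k::field) \<Rightarrow> 'v list \<Rightarrow> 'k" where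
  "path_weight w vs = (\<Prod>i<length vs - 1. w (vs ! i) (vs ! Suc i))"

definition Theta :: "'x list set \<Rightarrow> 'x list list \<Rightarrow> 'x list list \<Rightarrow> 'k::field" where
  "Theta R c c' = (\<Sum>vs\<in>paths (GM_weight R :: _ \<Rightarrow> _ \<Rightarrow> 'k) c c'. path_weight (GM_weight R) vs)"

text \<open>Edges preserve the total monomial \<^term>\<open>concat c\<close>, and the graph with weights
  \<^const>\<open>GM_weight\<close> is acyclic; so \<^const>\<open>Theta\<close> sums over finitely many paths, and the sums in \<open>proj\<close>
  and \<open>htpy\<close> (the maps \<open>p\<close> and \<open>h\<close>) have finite support, as \<^const>\<open>Sum_any\<close> requires.
  The space \<open>Tor\<close> is the span of the chains, inside the bar construction.\<close>

definition proj :: "'x list set \<Rightarrow> 'x list list \<Rightarrow> ('x list list \<Rightarrow>\<^sub>0 'k::field)" where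
  "proj R c = Sum_any (\<lambda>c'. if \<exists>r. chain R r c' \<and> length c' = length c
                            then Poly_Mapping.single c' (Theta R c c') else 0)"

definition htpy :: "'x list set \<Rightarrow> 'x list list \<Rightarrow> ('x list list \<Rightarrow>\<^sub>0 'k::field)" where
  "htpy R c = Sum_any (\<lambda>c'. if bar_term R c' \<and> length c' = length c + 1
                            then Poly_Mapping.single c' (Theta R c c') else 0)"

definition incl :: "'x list list \<Rightarrow> ('x list list \<Rightarrow>\<^sub>0 'k::field)" where
  "incl \<gamma> = Poly_Mapping.single \<gamma> 1"


section \<open>The transferred structure\<close>

text \<open>The tensor product of two linear maps, on a basis element \<open>[x, y]\<close> of the tensor square, with
  the Koszul sign \<open>(-1)\<^bsup>|g||x|\<^esup>\<close>; the argument \<open>e\<close> is the degree of \<open>g\<close>, and \<open>|x|\<close> is the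
  length of the bar term \<open>x\<close>.\<close>

definition koszul_tensor ::
  "nat \<Rightarrow> ('x list list \<Rightarrow> ('b list \<Rightarrow>\<^sub>0 'k)) \<Rightarrow> ('x list list \<Rightarrow> ('b list \<Rightarrow>\<^sub>0 'k)) \<Rightarrow>
   'x list list list \<Rightarrow> ('b list \<Rightarrow>\<^sub>0 'k::field)" where
  "koszul_tensor e f g xy =
     scale ((-1) ^ (e * length (xy ! 0))) (tens (f (xy ! 0)) (g (xy ! 1)))"

text \<open>\<open>after_h R s f\<close> is \<open>f \<circ> h\<close>, except that it is the identity for \<open>s = 1\<close> (the convention
  \<open>\<Delta>\<^sub>1'h = 1\<close>).\<close>

definition after_h :: "'x list set \<Rightarrow> nat \<Rightarrow> ('x list list \<Rightarrow> ('x list list list \<Rightarrow>\<^sub>0 'k)) \<Rightarrow>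
   'x list list \<Rightarrow> ('x list list list \<Rightarrow>\<^sub>0 'k::field)" where
  "after_h R s f c = (if s = 1 then Poly_Mapping.single [c] 1 else lin f (htpy R c))"

text \<open>\<open>\<Delta>\<^sub>s'\<close> has degree \<open>s - 2\<close> and \<open>h\<close> has degree \<open>1\<close>, hence \<open>\<Delta>\<^sub>t'h\<close> has degree \<open>t - 1\<close>; this
  includes the case \<open>t = 1\<close>. The value for \<open>n < 2\<close> is a dummy, never used by \<open>after_h\<close>.\<close>

function Delta' :: "'x list set \<Rightarrow> nat \<Rightarrow> 'x list list \<Rightarrow> ('x list list list \<Rightarrow>\<^sub>0 'k::field)" where
  "Delta' R n =
     (if n < 2 then (\<lambda>c. 0)
      else if n = 2 then bar_coproduct
      else (\<lambda>c. \<Sum>s\<in>{1..<n}. scale ((-1) ^ (s * (n - s + 1)))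
             (lin (koszul_tensor (n - s - 1) (after_h R s (Delta' R s))
                                             (after_h R (n - s) (Delta' R (n - s))))
                  (bar_coproduct c))))"
  by pat_completeness auto
termination by (relation "Wellfounded.measure snd") auto

declare Delta'.simps [simp del]

definition Delta :: "'x list set \<Rightarrow> nat \<Rightarrow> 'x list list \<Rightarrow> ('x list list list \<Rightarrow>\<^sub>0 'k::field)" where
  "Delta R n \<gamma> = lin (tensor_power (proj R)) (lin (Delta' R n) (incl \<gamma>))"

end

theory Submission
  imports Defs
begin

text \<open>The maps \<open>p\<close> and \<open>h\<close> are computed by one deterministic procedure.  Every monomial carries a greedy
sequence of bars: the first letter, then again and again the shortest piece whose product with the
previous piece vanishes.  A bar term that begins with some of these bars is read from the left.  If its
next bar \<open>v\<close> has zero product with the preceding greedy bar, but not minimally, or if \<open>v\<close> is the first bar and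
not a letter, then \<open>v\<close> is cut as \<open>v = a b\<close>, with \<open>a\<close> the next greedy bar; the bar term with this additional cut is a summand of \<open>h\<close>.
If \<open>b\<close> has nonzero product with the bar behind it, \<open>b\<close> is merged into that bar and the procedure goes
on; otherwise it stops.  All other edges out of the cut bar term lead to vertices from which no path
reaches anything relevant.  So \<open>h(c)\<close> is, up to signs, the sum of the cut bar terms on the
way (\<open>htpy_split\<close>), and \<open>p(c)\<close> is the chain at which the procedure ends, or \<open>0\<close> (\<open>proj_split\<close>).

A prefix of such a cut bar term is a chain, or it contains the new cut in its interior and is killed
by \<open>h\<close> and \<open>p\<close>.  Since \<open>h\<close> vanishes on chains too, only the summands
\<open>1 \<otimes> \<Delta>'\<^bsub>n-1\<^esub> h\<close> of \<open>\<Delta>'\<^sub>n\<close> contribute, and \<open>\<Delta>\<^sub>n\<close> is an iteration: split off a chain, apply \<open>h\<close> to the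
rest, split off a chain, and so on (\<open>transfer_split\<close>, \<open>transfer_chain\<close>).

It remains to see which cuts matter.  Group the bars of a bar term into pairs from the left.  If the
first pair that fails to vanish minimally has a nonzero product, then every iteration gives \<open>0\<close>
(\<open>transfer_h_defective\<close>).  This removes all cuts after which the procedure goes on, and, for the
cut at which it stops, all splittings into a chain with an even number of bars and a rest.
What is left is a single cut bar term, so that no two terms can cancel or add up, and all coefficients
are \<open>0\<close> or \<open>\<plusminus>1\<close>.

That every decomposition really occurs is shown by an invariant of the rests, called \<open>interlaced\<close>
below: the word of a proper tail of a chain carries two greedy sequences that interleave strictly, and
this keeps the procedure from running into a nonzero product too early (\<open>trajectory\<close>).
A count of bars against disjoint vanishing pairs (\<open>chains_count_bound\<close>) shows that every tuple
of chains with the right word and the right number of bars begins with one of the chains that are split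
off.  Both facts together give the coefficients (\<open>lookup_transfer_h_interlaced\<close>, \<open>lookup_Delta\<close>).

For the sign: on these rests, the cut at which the procedure stops comes after an odd number of greedy bars, so each of
the \<open>n - 2\<close> applications of \<open>h\<close> contributes \<open>-1\<close>, and the Koszul and structural signs are trivial
except for the first splitting, which gives \<open>(-1)\<^bsup>n r\<^sub>1\<^esup>\<close>.  As \<open>r\<^sub>2, \<dots>, r\<^bsub>n-1\<^esub>\<close> are even, \<open>n r\<^sub>1 + n\<close> has
the parity of \<open>N\<close> (\<open>sign_parity\<close>).\<close>


section \<open>Chains and the matching\<close>

definition is_chain :: "'x list set \<Rightarrow> 'x list list \<Rightarrow> bool" where
  "is_chain R c \<longleftrightarrow> (\<exists>r. chain R r c)"

lemma chain_iff_is_chain: "chain R r c \<longleftrightarrow> is_chain R c \<and> length c = r + 1"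
  by (auto simp: is_chain_def chain_def)

lemma is_chain_iff:
  "is_chain R c \<longleftrightarrow> bar_term R c \<and> length (hd c) = 1 \<and> successively (zero_minimally R) c"
proof -
  have "is_chain R c \<longleftrightarrow> chain R (length c - 1) c"
    by (auto simp: is_chain_def chain_def)
  then show ?thesis
    by (cases c) (auto simp: chain_def bar_term_def successively_conv_nth hd_conv_nth)
qed

lemma is_chainD:
  assumes "is_chain R c"
  shows "bar_term R c" "length (hd c) = 1" "successively (zero_minimally R) c" "c \<noteq> []"
  using assms by (auto simp: is_chain_iff bar_term_def)

lemma is_chain_prefix: "is_chain R (ps @ qs) \<Longrightarrow> ps \<noteq> [] \<Longrightarrow> is_chain R ps"
  by (auto simp: is_chain_iff bar_term_def successively_append_iff)

text \<open>The reason for all uniqueness statements below: the bars of a chain are determined by its word from the left.\<close>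

lemma is_chain_last_unique:
  assumes "is_chain R (ps @ [a])" "is_chain R (ps @ [a @ b])"
  shows "b = []"
proof (cases ps rule: rev_cases)
  case Nil
  then show ?thesis using assms by (auto simp: is_chain_iff bar_term_def)
next
  case (snoc qs u)
  then have "zero_minimally R u a" "zero_minimally R u (a @ b)"
    using assms by (auto simp: is_chain_iff successively_append_iff)
  then show ?thesis unfolding zero_minimally_def by (metis append_Nil2 prefix_order.le_imp_less_or_eq prefixI same_append_eq)
qed

text \<open>In terms of lists, a matched pair consists of a bar term whose bar behind \<open>ps\<close> is cut so that the first
piece continues the chain \<open>ps\<close>, and of the bar term without that cut.\<close>

lemma matched_iff:
  "matched R d c \<longleftrightarrow> bar_term R d \<and> (\<exists>ps a b vs. d = ps @ a # b # vs \<and> c = ps @ (a @ b) # vs \<and>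
     is_chain R (ps @ [a]) \<and> normal R (a @ b))"
proof (intro iffI conjI)
  assume m: "matched R d c"
  then show "bar_term R d" by (simp add: matched_def)
  from m obtain j where j: "1 \<le> j" "j < length d"
    and z: "\<And>i. Suc i < j \<Longrightarrow> zero_minimally R (d ! i) (d ! Suc i)"
    and n: "normal R (d ! (j - 1) @ d ! j)" and c: "c = merge (j - 1) d"
    and l: "length (d ! 0) = 1" and bd: "bar_term R d"
    unfolding matched_def by blast
  define p where "p = j - 1"
  have jp: "j = Suc p" using j by (simp add: p_def)
  have "drop p d = d ! p # d ! Suc p # drop (p + 2) d"
    using j by (simp add: jp Cons_nth_drop_Suc)
  then have d: "d = take p d @ d ! p # d ! Suc p # drop (p + 2) d"
    by (metis append_take_drop_id)
  have c': "c = take p d @ (d ! p @ d ! Suc p) # drop (p + 2) d"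
    using c by (simp add: merge_def jp)
  have "is_chain R (take (Suc p) d)"
    unfolding is_chain_iff using bd l j z
    by (auto simp: jp bar_term_def successively_conv_nth hd_conv_nth dest: in_set_takeD)
  then have "is_chain R (take p d @ [d ! p])" using j by (simp add: jp take_Suc_conv_app_nth)
  then show "\<exists>ps a b vs. d = ps @ a # b # vs \<and> c = ps @ (a @ b) # vs \<and>
     is_chain R (ps @ [a]) \<and> normal R (a @ b)" using d c' n jp by (metis diff_Suc_1)
next
  assume "bar_term R d \<and> (\<exists>ps a b vs. d = ps @ a # b # vs \<and> c = ps @ (a @ b) # vs \<and>
     is_chain R (ps @ [a]) \<and> normal R (a @ b))"
  then obtain ps a b vs where d: "d = ps @ a # b # vs" and c: "c = ps @ (a @ b) # vs"
    and ch: "is_chain R (ps @ [a])" and n: "normal R (a @ b)" and bd: "bar_term R d" by blast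
  have 1: "length (d ! 0) = 1"
    using is_chainD(2)[OF ch] by (cases ps) (auto simp: d)
  have 2: "zero_minimally R (d ! i) (d ! Suc i)" if "Suc i < length ps + 1" for i
    using is_chainD(3)[OF ch] that
    by (auto simp: d successively_conv_nth nth_append split: if_splits dest!: spec[of _ i])
  show "matched R d c"
    unfolding matched_def
    by (intro conjI bd 1 exI[of _ "length ps + 1"]) (use 2 n in \<open>auto simp: d c merge_def nth_append\<close>)
qed


lemma append_Cons_eq_longer:
  assumes "ps @ a # xs = ps' @ ys" "length ps < length ps'"
  obtains us where "ps' = ps @ a # us" "xs = us @ ys"
proof -
  have "take (Suc (length ps)) (ps' @ ys) = ps @ [a]" using assms(1)[symmetric] by simp
  then have "ps' = (ps @ [a]) @ drop (Suc (length ps)) ps'"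
    using assms(2) by (metis Suc_leI append_take_drop_id take_all_iff take_append append_Nil2
        diff_is_0_eq' take0)
  then show ?thesis using assms(1) that[of "drop (Suc (length ps)) ps'"]
    by (metis append_Cons append_Nil append_assoc list.inject same_append_eq)
qed

text \<open>If the bar \<open>a @ b\<close> properly contains the bar that continues the chain \<open>ps\<close>, then no chain formed by bars of
this bar term reaches past \<open>a @ b\<close>.\<close>

lemma is_chain_split_le:
  assumes "is_chain R (ps @ [a])" "b \<noteq> []" "ps @ (a @ b) # vs = ps' @ y # vs'" "is_chain R (ps' @ [x])"
  shows "length ps' \<le> length ps"
proof (rule ccontr)
  assume "\<not> ?thesis"
  then obtain zs where "ps' = ps @ (a @ b) # zs"
    using append_Cons_eq_longer[OF assms(3)] by (metis not_le)
  then have "is_chain R (ps @ [a @ b])"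
    using is_chain_prefix[of R "ps @ [a @ b]" "zs @ [x]"] assms(4) by simp
  then show False using is_chain_last_unique assms(1,2) by blast
qed

lemma is_chain_split_less:
  assumes "is_chain R (ps @ [a])" "b \<noteq> []" "ps @ (a @ b) # vs = ps' @ x # vs'" "is_chain R (ps' @ [x])"
  shows "length ps' < length ps"
proof -
  have "length ps' \<le> length ps" by (rule is_chain_split_le[OF assms])
  moreover have "length ps' \<noteq> length ps"
    using assms is_chain_last_unique[of R ps a b] by auto
  ultimately show ?thesis by simp
qed

text \<open>In the inverted graph an inverted edge leads from a
lower vertex to its upper partner.\<close>

definition upper :: "'x list set \<Rightarrow> 'x list list \<Rightarrow> bool" where
  "upper R d \<longleftrightarrow> (\<exists>c. matched R d c)"

definition lower :: "'x list set \<Rightarrow> 'x list list \<Rightarrow> bool" where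
  "lower R c \<longleftrightarrow> (\<exists>d. matched R d c)"

lemma matchedE:
  assumes "matched R d c"
  obtains ps a b vs where "d = ps @ a # b # vs" "c = ps @ (a @ b) # vs"
    "is_chain R (ps @ [a])" "a \<noteq> []" "b \<noteq> []" "normal R (a @ b)" "bar_term R d"
proof -
  obtain ps a b vs where "d = ps @ a # b # vs" "c = ps @ (a @ b) # vs"
    "is_chain R (ps @ [a])" "normal R (a @ b)" "bar_term R d" using assms by (auto simp: matched_iff)
  moreover from this have "a \<noteq> []" "b \<noteq> []" by (auto simp: bar_term_def)
  ultimately show ?thesis using that by blast
qed

lemma upper_iff:
  "upper R d \<longleftrightarrow> bar_term R d \<and>
     (\<exists>ps a b vs. d = ps @ a # b # vs \<and> is_chain R (ps @ [a]) \<and> normal R (a @ b))"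
  by (auto simp: upper_def matched_iff)

lemma is_chain_successive:
  assumes "is_chain R (ps @ a # b # vs)"
  shows "zero_minimally R a b"
  using assms by (auto simp: is_chain_iff successively_append_iff)

lemma is_chain_not_normal:
  assumes "is_chain R (ps @ a # b # vs)"
  shows "\<not> normal R (a @ b)"
  using is_chain_successive[OF assms] by (simp add: zero_minimally_def)

lemma matched_upper_unique:
  assumes "matched R d c" "matched R d c'"
  shows "c = c'"
proof -
  have *: "length ps' \<le> length ps"
    if eq: "ps @ a # b # vs = ps' @ a' # b' # vs'" and "normal R (a @ b)" "is_chain R (ps' @ [a'])"
    for ps a b vs ps' a' b' and vs' :: "'a list list"
  proof (rule ccontr)
    assume "\<not> ?thesis"
    then obtain us where us: "ps' = ps @ a # us"
      using append_Cons_eq_longer[OF eq] by (metis not_le)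
    then have "us @ a' # b' # vs' = b # vs" using eq by simp
    then obtain zs where "us @ [a'] = b # zs" by (cases us) auto
    then have "is_chain R (ps @ a # b # zs)" using that(3) us by simp
    then show False using that(2) is_chain_not_normal by metis
  qed
  obtain ps a b vs where 1: "d = ps @ a # b # vs" "c = ps @ (a @ b) # vs"
    "is_chain R (ps @ [a])" "normal R (a @ b)" using assms(1) by (auto simp: matched_iff)
  obtain ps' a' b' vs' where 2: "d = ps' @ a' # b' # vs'" "c' = ps' @ (a' @ b') # vs'"
    "is_chain R (ps' @ [a'])" "normal R (a' @ b')" using assms(2) by (auto simp: matched_iff)
  have "length ps = length ps'" using *[of ps a b vs ps' a' b' vs'] *[of ps' a' b' vs' ps a b vs] 1 2 by force
  then show ?thesis using 1 2 by simp
qed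

lemma matched_lower_unique:
  assumes "matched R d c" "matched R d' c"
  shows "d = d'"
proof -
  obtain ps a b vs where 1: "d = ps @ a # b # vs" "c = ps @ (a @ b) # vs"
    "is_chain R (ps @ [a])" "b \<noteq> []" using assms(1) by (auto elim!: matchedE)
  obtain ps' a' b' vs' where 2: "d' = ps' @ a' # b' # vs'" "c = ps' @ (a' @ b') # vs'"
    "is_chain R (ps' @ [a'])" "b' \<noteq> []" using assms(2) by (auto elim!: matchedE)
  have "length ps = length ps'"
    using is_chain_split_le[OF 1(3,4) _ 2(3)] is_chain_split_le[OF 2(3,4) _ 1(3)] 1(2) 2(2)
    by (metis le_antisym)
  then have ps: "ps = ps'" "a @ b = a' @ b'" "vs = vs'" using 1 2 by auto
  from ps(2) consider us where "a = a' @ us" | us where "a' = a @ us"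
    by (auto simp: append_eq_append_conv2)
  then have "a = a'" using is_chain_last_unique 1 2 ps(1) by (cases; force)
  then show ?thesis using ps 1 2 by simp
qed

text \<open>Behind the initial greedy bars an upper bar term continues with a product that is nonzero, a lower one with a
product that is zero.  Thus the matched edges have no common vertices.\<close>

lemma not_upper_and_lower:
  assumes "upper R d" "lower R d"
  shows False
proof -
  obtain ps a b vs where 1: "d = ps @ a # b # vs" "is_chain R (ps @ [a])" "normal R (a @ b)"
    using assms(1) by (auto simp: upper_iff)
  obtain ps' a' b' vs' where 2: "d = ps' @ (a' @ b') # vs'"
    "is_chain R (ps' @ [a'])" "b' \<noteq> []" using assms(2) by (auto simp: lower_def elim!: matchedE)
  have "length ps < length ps'" using is_chain_split_less[of R ps' a' b' vs' ps a "b # vs"] 1 2 by simp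
  then obtain zs where zs: "ps' = ps @ a # zs"
    using append_Cons_eq_longer[of ps a "b # vs" ps'] 1(1) 2(1) by metis
  show False
  proof (cases zs)
    case Nil
    then have "b = a' @ b'" using 1 2 zs by auto
    moreover have "\<not> normal R (a @ a')"
      using is_chain_not_normal[of R ps a a' "[]"] 2(2) zs Nil by simp
    ultimately show False using 1(3) not_normal_append(2)[of R "a @ a'" b'] by simp
  next
    case (Cons z zs')
    then have "z = b" using 1 2 zs by auto
    then show False using 1(3) is_chain_not_normal[of R ps a b "zs' @ [a']"] 2(2) zs Cons by simp
  qed
qed

lemma is_chain_not_upper: "is_chain R c \<Longrightarrow> \<not> upper R c"
  by (auto simp: upper_iff dest: is_chain_not_normal)

lemma is_chain_not_lower:
  assumes "is_chain R c"
  shows "\<not> lower R c"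
proof
  assume "lower R c"
  then obtain ps a b vs where 2: "c = ps @ (a @ b) # vs"
    "is_chain R (ps @ [a])" "b \<noteq> []" by (auto simp: lower_def elim!: matchedE)
  then have "is_chain R (ps @ [a @ b])" using is_chain_prefix[of R "ps @ [a @ b]" vs] assms by simp
  then show False using is_chain_last_unique 2 by blast
qed

lemma matched_length: "matched R d c \<Longrightarrow> length d = length c + 1"
  by (auto simp: matched_iff)

lemma matched_merge:
  "d = ps @ a # b # vs \<Longrightarrow> merge (length ps) d = ps @ (a @ b) # vs"
  by (auto simp: merge_def nth_append)

lemma length_merge: "Suc i < length c \<Longrightarrow> length (merge i c) = length c - 1"
  by (auto simp: merge_def)

text \<open>Merging at the earlier position lengthens the bar at that position, because no bar is empty.
So the summands of the differential never collect.\<close>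

lemma merge_inj:
  assumes "bar_term R c" "Suc i < length c" "Suc j < length c" "merge i c = merge j c"
  shows "i = j"
proof -
  have *: False if "Suc i < length c" "Suc j < length c" "merge i c = merge j c" "i < j" for i j
  proof -
    have "merge i c ! i = c ! i @ c ! Suc i" using that(1) by (simp add: merge_def nth_append)
    moreover have "merge j c ! i = c ! i" using that(2,4) by (simp add: merge_def nth_append)
    ultimately have "c ! Suc i = []" using that(3) by (metis append_self_conv)
    then show False using assms(1) that nth_mem[of "Suc i" c] by (auto simp: bar_term_def)
  qed
  then show ?thesis using assms by (metis linorder_neqE_nat)
qed

lemma G_weight_merge:
  assumes "bar_term R c" "Suc i < length c"
  shows "(G_weight R c (merge i c) :: 'k::field) = (if normal R (c ! i @ c ! Suc i) then (-1) ^ i else 0)"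
proof -
  have inj: "merge j c = merge i c \<longleftrightarrow> j = i" if "j < length c - 1" for j
    using merge_inj[OF assms(1) _ assms(2), of j] that by auto
  have "(G_weight R c (merge i c) :: 'k) = (\<Sum>j<length c - 1.
      if normal R (c ! j @ c ! Suc j) \<and> j = i then (-1) ^ j else 0)"
    using assms
    by (auto simp: G_weight_def bar_d_def lookup_sum lookup_single when_def inj intro!: sum.cong)
  also have "\<dots> = (\<Sum>j<length c - 1. if j = i then (if normal R (c ! i @ c ! Suc i) then (-1) ^ i else 0) else 0)"
    by (rule sum.cong) auto
  also have "\<dots> = (if normal R (c ! i @ c ! Suc i) then (-1) ^ i else 0)"
    using assms(2) by (subst sum.delta) auto
  finally show ?thesis .
qed

lemma G_weight_nonzero:
  assumes "(G_weight R c c' :: 'k::field) \<noteq> 0"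
  shows "bar_term R c" "\<exists>i. Suc i < length c \<and> normal R (c ! i @ c ! Suc i) \<and> c' = merge i c"
proof -
  show "bar_term R c" using assms by (auto simp: G_weight_def split: if_splits)
  then have "(\<Sum>i<length c - 1. Poly_Mapping.lookup (if normal R (c ! i @ c ! Suc i)
      then Poly_Mapping.single (merge i c) ((-1) ^ i) else 0 :: _ \<Rightarrow>\<^sub>0 'k) c') \<noteq> 0"
    using assms by (auto simp: G_weight_def bar_d_def lookup_sum)
  then obtain i where "i < length c - 1" "Poly_Mapping.lookup (if normal R (c ! i @ c ! Suc i)
      then Poly_Mapping.single (merge i c) ((-1) ^ i) else 0 :: _ \<Rightarrow>\<^sub>0 'k) c' \<noteq> 0"
    by (meson lessThan_iff sum.not_neutral_contains_not_neutral)
  then show "\<exists>i. Suc i < length c \<and> normal R (c ! i @ c ! Suc i) \<and> c' = merge i c"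
    by (intro exI[of _ i]) (auto split: if_splits simp: lookup_single when_def)
qed

lemma matched_G_weight:
  assumes "bar_term R (ps @ a # b # vs)" "normal R (a @ b)"
  shows "(G_weight R (ps @ a # b # vs) (ps @ (a @ b) # vs) :: 'k::field) = (-1) ^ length ps"
  using G_weight_merge[OF assms(1), of "length ps", where 'k = 'k] assms(2)
  by (simp add: matched_merge nth_append)

lemma GM_edge:
  assumes "(GM_weight R c c' :: 'k::field) \<noteq> 0"
  shows "matched R c' c \<or> \<not> matched R c c' \<and> bar_term R c \<and>
    (\<exists>i. Suc i < length c \<and> normal R (c ! i @ c ! Suc i) \<and> c' = merge i c)"
  using assms G_weight_nonzero[of R c c', where 'k='k]
  by (auto simp: GM_weight_def split: if_splits)

lemma GM_edge_length:
  assumes "(GM_weight R c c' :: 'k::field) \<noteq> 0"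
  shows "matched R c' c \<or> length c = length c' + 1"
  using GM_edge[OF assms] length_merge by fastforce

section \<open>Paths and the recursion for the contraction\<close>

lemma paths_eq:
  "paths w c e = (if c = e then {[c]} else {}) \<union> (\<Union>y\<in>{y. w c y \<noteq> 0}. (#) c ` paths w y e)"
proof (intro equalityI subsetI)
  fix vs assume "vs \<in> paths w c e"
  then obtain ws where vs: "vs = c # ws" and l: "last (c # ws) = e" and s: "successively (\<lambda>a b. w a b \<noteq> 0) (c # ws)"
    by (cases vs) (auto simp: paths_def)
  show "vs \<in> (if c = e then {[c]} else {}) \<union> (\<Union>y\<in>{y. w c y \<noteq> 0}. (#) c ` paths w y e)"
    using vs l s by (cases ws) (auto simp: paths_def)
next
  fix vs assume "vs \<in> (if c = e then {[c]} else {}) \<union> (\<Union>y\<in>{y. w c y \<noteq> 0}. (#) c ` paths w y e)"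
  then show "vs \<in> paths w c e"
    by (auto simp: paths_def successively_Cons split: if_splits)
qed

lemma path_weight_Cons:
  assumes "vs \<in> paths w y e"
  shows "path_weight w (c # vs) = w c y * path_weight w vs"
proof (cases vs)
  case (Cons z zs)
  then have "z = y" using assms by (auto simp: paths_def)
  then show ?thesis using Cons
    by (simp add: path_weight_def prod.lessThan_Suc_shift del: prod.lessThan_Suc)
qed (use assms in \<open>simp add: paths_def\<close>)

text \<open>An inverted edge ends in an upper vertex, and all edges out of an upper vertex shorten the bar term.
Therefore a path gains at most one bar altogether, and it ends in an upper vertex if it gains one.\<close>

lemma path_bounds:
  assumes "vs \<in> paths (GM_weight R :: _ \<Rightarrow> _ \<Rightarrow> 'k::field) c e"
  shows "length e \<le> length c + 1 \<and> (length e = length c + 1 \<longrightarrow> upper R e) \<and>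
    (\<not> lower R c \<longrightarrow> length e \<le> length c \<and> (length e = length c \<longrightarrow> e = c \<or> upper R e))"
  using assms
proof (induction vs arbitrary: c)
  case Nil
  then show ?case by (simp add: paths_def)
next
  case (Cons v vs)
  from Cons.prems consider "e = c"
    | y where "(GM_weight R c y :: 'k) \<noteq> 0" "vs \<in> paths (GM_weight R :: _ \<Rightarrow> _ \<Rightarrow> 'k) y e"
    by (subst (asm) paths_eq) (auto split: if_splits)
  then show ?case
  proof cases
    case 1
    then show ?thesis by simp
  next
    case 2
    note IH = Cons.IH[OF 2(2)]
    from GM_edge_length[OF 2(1)] show ?thesis
    proof
      assume m: "matched R y c"
      then have "length y = length c + 1" "lower R c" "upper R y"
        by (auto simp: matched_length lower_def upper_def)
      moreover from this have "\<not> lower R y" using not_upper_and_lower by blast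
      ultimately show ?thesis using IH by auto
    next
      assume "length c = length y + 1"
      then show ?thesis using IH by auto
    qed
  qed
qed

text \<open>The vertices at which the paths that define \<open>h\<close> (one bar more) and \<open>p\<close> (a chain with as many bars) end, if
they start in a bar term with \<open>l\<close> bars.\<close>

definition target :: "'x list set \<Rightarrow> nat \<Rightarrow> 'x list list \<Rightarrow> bool" where
  "target R l e \<longleftrightarrow> length e = l + 1 \<or> length e = l \<and> is_chain R e"

lemma no_path_from_shorter:
  assumes "target R (length c) e" "length c = length y + 1"
  shows "paths (GM_weight R :: _ \<Rightarrow> _ \<Rightarrow> 'k::field) y e = {}"
proof (rule ccontr)
  assume "paths (GM_weight R :: _ \<Rightarrow> _ \<Rightarrow> 'k) y e \<noteq> {}"
  then obtain vs where "vs \<in> paths (GM_weight R :: _ \<Rightarrow> _ \<Rightarrow> 'k) y e" by blast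
  from path_bounds[OF this] show False
    using assms is_chain_not_upper by (auto simp: target_def)
qed

lemma paths_not_lower:
  assumes "\<not> lower R c" "target R (length c) e"
  shows "paths (GM_weight R :: _ \<Rightarrow> _ \<Rightarrow> 'k::field) c e = (if c = e then {[c]} else {})"
proof -
  have "paths (GM_weight R :: _ \<Rightarrow> _ \<Rightarrow> 'k::field) y e = {}" if "(GM_weight R c y :: 'k) \<noteq> 0" for y
    using GM_edge_length[OF that] assms no_path_from_shorter[OF assms(2)] by (auto simp: lower_def)
  then show ?thesis by (subst paths_eq) auto
qed

lemma Theta_not_lower:
  assumes "\<not> lower R c" "target R (length c) e"
  shows "(Theta R c e :: 'k::field) = (if c = e then 1 else 0)"
  by (simp add: Theta_def paths_not_lower[OF assms] path_weight_def)

text \<open>The bar term at which the greedy procedure continues after the bar \<open>a @ b\<close> has been cut: the rest \<open>b\<close> is merged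
into the next bar.  The set has at most one element, so that a sum over it is either one term or zero.\<close>

fun onward :: "'x list set \<Rightarrow> 'x list list \<Rightarrow> 'x list \<Rightarrow> 'x list \<Rightarrow> 'x list list \<Rightarrow> 'x list list set" where
  "onward R ps a b [] = {}"
| "onward R ps a b (v # vs) = (if normal R (b @ v) then {ps @ a # (b @ v) # vs} else {})"

context
  fixes R :: "'x list set" and ps a b vs
  assumes bt: "bar_term R (ps @ a # b # vs)" and ch: "is_chain R (ps @ [a])" and n: "normal R (a @ b)"
begin

private abbreviation (input) "c \<equiv> ps @ (a @ b) # vs"
private abbreviation (input) "d \<equiv> ps @ a # b # vs"

lemma matched_split: "matched R d c"
  using bt ch n by (auto simp: matched_iff)

lemma GM_weight_up: "(GM_weight R c d :: 'k::field) = (-1) ^ (length ps + 1)"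
proof -
  have "\<not> matched R c d" using matched_length[OF matched_split] matched_length[of R c d] by auto
  then show ?thesis using matched_split matched_G_weight[OF bt n, where 'k='k]
    by (simp add: GM_weight_def power_inverse[symmetric])
qed

lemma paths_split_up:
  assumes "target R (length c) e"
  shows "paths (GM_weight R :: _ \<Rightarrow> _ \<Rightarrow> 'k::field) c e = (#) c ` paths (GM_weight R :: _ \<Rightarrow> _ \<Rightarrow> 'k) d e"
proof -
  have "lower R c" using matched_split by (auto simp: lower_def)
  then have "c \<noteq> e" using assms is_chain_not_lower by (auto simp: target_def)
  moreover have "y = d" if "(GM_weight R c y :: 'k) \<noteq> 0" "paths (GM_weight R :: _ \<Rightarrow> _ \<Rightarrow> 'k) y e \<noteq> {}" for y
  proof -
    from GM_edge_length[OF that(1)] have "matched R y c"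
      using no_path_from_shorter[OF assms] that(2) by blast
    then show ?thesis using matched_lower_unique matched_split by blast
  qed
  moreover have "(GM_weight R c d :: 'k) \<noteq> 0" by (simp add: GM_weight_up)
  ultimately show ?thesis by (subst paths_eq) auto
qed

text \<open>Merging before the cut gives zero, merging at the cut inverts an inverted edge, and merging further
to the right than just behind the cut leaves the cut visible, so that the result is upper.\<close>

lemma step_down:
  assumes "(GM_weight R d y :: 'k::field) \<noteq> 0" "\<not> upper R y"
  shows "y \<in> onward R ps a b vs"
proof -
  have u: "upper R d" using matched_split by (auto simp: upper_def)
  then have "\<not> lower R d" using not_upper_and_lower by blast
  then obtain i where i: "Suc i < length d" "normal R (d ! i @ d ! Suc i)" "y = merge i d" "\<not> matched R d y"
    using GM_edge[OF assms(1)] by (auto simp: lower_def)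
  consider "i < length ps" | "i = length ps" | "i = length ps + 1" | "i > length ps + 1" by linarith
  then show ?thesis
  proof cases
    case 1
    then have "zero_minimally R ((ps @ [a]) ! i) ((ps @ [a]) ! Suc i)"
      using is_chainD(3)[OF ch] by (auto simp: successively_conv_nth)
    moreover have "d ! i = (ps @ [a]) ! i" "d ! Suc i = (ps @ [a]) ! Suc i"
      using 1 by (auto simp: nth_append)
    ultimately show ?thesis using i(2) by (auto simp: zero_minimally_def)
  next
    case 2
    then show ?thesis using i(3,4) matched_split by (simp add: matched_merge)
  next
    case 3
    then obtain v us where vs: "vs = v # us" using i(1) by (cases vs) auto
    have "y = ps @ a # (b @ v) # us"
      using matched_merge[of d "ps @ [a]" b v us] i(3) 3 vs by simp
    moreover have "normal R (b @ v)" using i(2) 3 vs by (simp add: nth_append)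
    ultimately show ?thesis using vs by simp
  next
    case 4
    then have "length ps + 2 \<le> i" by simp
    then obtain k where k: "i = length ps + 2 + k" by (rule less_eqE)
    have nth: "d ! i = vs ! k" "d ! Suc i = vs ! Suc k" by (simp_all add: k nth_append)
    have "take i d = ps @ a # b # take k vs" "drop (i + 2) d = drop (k + 2) vs"
      by (simp_all add: k numeral_eq_Suc)
    then have y: "y = ps @ a # b # merge k vs" using i(3) nth by (simp add: merge_def)
    have lk: "Suc k < length vs" using i(1) k by simp
    then have "vs ! k \<in> set vs" by simp
    then have "vs ! k @ vs ! Suc k \<noteq> []" using bt by (auto simp: bar_term_def)
    moreover have "set (merge k vs) \<subseteq> insert (vs ! k @ vs ! Suc k) (set vs)"
      by (auto simp: merge_def dest: in_set_takeD in_set_dropD)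
    moreover have "normal R (vs ! k @ vs ! Suc k)" using i(2) nth by simp
    ultimately have "bar_term R y" using bt unfolding y by (auto simp: bar_term_def)
    then have "upper R y" unfolding upper_iff y using ch n by blast
    then show ?thesis using assms(2) by simp
  qed
qed

lemma GM_weight_down:
  assumes "y \<in> onward R ps a b vs"
  shows "(GM_weight R d y :: 'k::field) = (-1) ^ (length ps + 1)" and "length y = length c"
proof -
  obtain v us where vs: "vs = v # us" and nv: "normal R (b @ v)" and y: "y = ps @ a # (b @ v) # us"
    using assms by (cases vs) (auto split: if_splits)
  show "length y = length c" by (simp add: y vs)
  have "y \<noteq> c" using bt by (auto simp: y vs bar_term_def)
  then have 1: "\<not> matched R d y" using matched_split matched_upper_unique by blast
  have "upper R d" using matched_split by (auto simp: upper_def)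
  then have 2: "\<not> matched R y d" using not_upper_and_lower by (auto simp: lower_def)
  show "(GM_weight R d y :: 'k) = (-1) ^ (length ps + 1)"
    using 1 2 matched_G_weight[of R "ps @ [a]" b v us, where 'k = 'k] bt nv
    by (simp add: GM_weight_def y vs)
qed

lemma paths_split_down:
  assumes "target R (length c) e"
  shows "paths (GM_weight R :: _ \<Rightarrow> _ \<Rightarrow> 'k::field) d e =
    (if d = e then {[d]} else {}) \<union> (\<Union>y\<in>onward R ps a b vs. (#) d ` paths (GM_weight R :: _ \<Rightarrow> _ \<Rightarrow> 'k) y e)"
proof -
  have "y \<in> onward R ps a b vs"
    if "(GM_weight R d y :: 'k) \<noteq> 0" "vs' \<in> paths (GM_weight R :: _ \<Rightarrow> _ \<Rightarrow> 'k) y e" for y vs'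
  proof (rule step_down[OF that(1)])
    show "\<not> upper R y"
    proof
      assume "upper R y"
      then have nl: "\<not> lower R y" using not_upper_and_lower by blast
      have "\<not> lower R d" using matched_split not_upper_and_lower by (auto simp: upper_def)
      then have "length d = length y + 1" using GM_edge_length[OF that(1)] by (auto simp: lower_def)
      then have l: "length y = length c" by simp
      then have "vs' \<in> (if y = e then {[y]} else {})"
        using paths_not_lower[OF nl, of e, where 'k='k] assms that(2) by simp
      then have "y = e" by (auto split: if_splits)
      then show False using assms l \<open>upper R y\<close> is_chain_not_upper by (auto simp: target_def)
    qed
  qed
  moreover have "(GM_weight R d y :: 'k) \<noteq> 0" if "y \<in> onward R ps a b vs" for y
    using GM_weight_down(1)[OF that, where 'k='k] by simp
  ultimately show ?thesis by (subst paths_eq) blast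
qed

lemma onward_cases: "onward R ps a b vs = {} \<or> (\<exists>y. onward R ps a b vs = {y})"
proof (cases vs)
  case (Cons v us)
  show ?thesis
  proof (cases "normal R (b @ v)")
    case True
    then have "onward R ps a b vs = {ps @ a # (b @ v) # us}" by (simp add: Cons)
    then show ?thesis by blast
  qed (simp add: Cons)
qed simp

lemma finite_paths_onward:
  assumes "target R (length c) e"
    and "\<And>y. y \<in> onward R ps a b vs \<Longrightarrow> finite (paths (GM_weight R :: _ \<Rightarrow> _ \<Rightarrow> 'k::field) y e)"
  shows "finite (paths (GM_weight R :: _ \<Rightarrow> _ \<Rightarrow> 'k) c e)"
proof -
  have "finite (onward R ps a b vs)" using onward_cases by (metis finite.emptyI finite.insertI)
  then show ?thesis unfolding paths_split_up[OF assms(1)] paths_split_down[OF assms(1)]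
    using assms(2) by auto
qed

text \<open>Every relevant path out of a lower vertex starts with the inverted edge and then stops or moves onward.
The two edges have the weights \<open>- (-1)\<^bsup>k\<^esup>\<close> and \<open>(-1)\<^bsup>k+1\<^esup>\<close> with \<open>k = length ps\<close>, so together they contribute
the factor \<open>1\<close>.\<close>

lemma Theta_onward:
  assumes "target R (length c) e"
    and "\<And>y. y \<in> onward R ps a b vs \<Longrightarrow> finite (paths (GM_weight R :: _ \<Rightarrow> _ \<Rightarrow> 'k::field) y e)"
  shows "(Theta R c e :: 'k) = (if d = e then (-1) ^ (length ps + 1) else 0) +
    (\<Sum>y\<in>onward R ps a b vs. Theta R y e)"
proof -
  let ?w = "GM_weight R :: _ \<Rightarrow> _ \<Rightarrow> 'k"
  let ?s = "(-1) ^ (length ps + 1) :: 'k"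
  have inj: "inj_on ((#) x) S" for x and S :: "'x list list list set" by (auto intro: inj_onI)
  have up: "path_weight ?w (c # p) = ?s * path_weight ?w p" if "p \<in> paths ?w d e" for p
    using path_weight_Cons[OF that, of c] by (simp only: GM_weight_up)
  have "Theta R c e = (\<Sum>p\<in>(#) c ` paths ?w d e. path_weight ?w p)"
    by (simp only: Theta_def paths_split_up[OF assms(1)])
  also have "\<dots> = (\<Sum>p\<in>paths ?w d e. path_weight ?w (c # p))"
    by (simp only: sum.reindex[OF inj] comp_def)
  also have "\<dots> = ?s * (\<Sum>p\<in>paths ?w d e. path_weight ?w p)"
    unfolding sum_distrib_left by (rule sum.cong[OF refl up])
  also have "(\<Sum>p\<in>paths ?w d e. path_weight ?w p) =
     (if d = e then 1 else 0) + ?s * (\<Sum>y\<in>onward R ps a b vs. Theta R y e)"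
    using onward_cases
  proof (elim disjE exE)
    assume "onward R ps a b vs = {}"
    then show ?thesis by (simp add: paths_split_down[OF assms(1)] path_weight_def)
  next
    fix y assume o: "onward R ps a b vs = {y}"
    then have y: "y \<in> onward R ps a b vs" by simp
    have ne: "[d] \<notin> (#) d ` paths ?w y e" by (auto simp: paths_def)
    have "(\<Sum>p\<in>paths ?w d e. path_weight ?w p) = (if d = e then 1 else 0) +
       (\<Sum>p\<in>(#) d ` paths ?w y e. path_weight ?w p)"
    proof (cases "d = e")
      case True
      have "path_weight ?w [d] = 1" by (simp add: path_weight_def)
      moreover have "paths ?w d e = insert [d] ((#) d ` paths ?w y e)"
        using True paths_split_down[OF assms(1), where 'k='k] by (simp add: o)
      ultimately show ?thesis using assms(2)[OF y] ne True by simp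
    next
      case False
      then show ?thesis using paths_split_down[OF assms(1), where 'k='k] by (simp add: o)
    qed
    also have "(\<Sum>p\<in>(#) d ` paths ?w y e. path_weight ?w p) = (\<Sum>p\<in>paths ?w y e. ?s * path_weight ?w p)"
      unfolding sum.reindex[OF inj] comp_def
      using path_weight_Cons[of _ ?w y e d] by (intro sum.cong[OF refl]) (simp only: GM_weight_down(1)[OF y])
    finally show ?thesis by (simp add: o Theta_def sum_distrib_left)
  qed
  finally have "Theta R c e = ?s * (if d = e then 1 else 0) + ?s * ?s * (\<Sum>y\<in>onward R ps a b vs. Theta R y e)"
    by (simp only: distrib_left mult.assoc)
  moreover have "?s * ?s = 1" by (simp flip: power_mult_distrib)
  ultimately show ?thesis by simp
qed

end

text \<open>Moving onward lengthens the initial segment of greedy bars while the number of bars stays the same; hence the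
procedure ends.\<close>

lemma greedy_induct:
  assumes not_lower: "\<And>c. \<not> lower R c \<Longrightarrow> P c"
    and split: "\<And>ps a b vs. bar_term R (ps @ a # b # vs) \<Longrightarrow> is_chain R (ps @ [a]) \<Longrightarrow> normal R (a @ b) \<Longrightarrow>
      (\<And>y. y \<in> onward R ps a b vs \<Longrightarrow> P y) \<Longrightarrow> P (ps @ (a @ b) # vs)"
  shows "P c"
proof -
  have main: "P (ps @ (a @ b) # vs)"
    if "bar_term R (ps @ a # b # vs)" "is_chain R (ps @ [a])" "normal R (a @ b)" for ps a b vs
    using that
  proof (induction "length vs" arbitrary: ps a b vs rule: less_induct)
    case less
    show ?case
    proof (rule split[OF less.prems])
      fix y assume y: "y \<in> onward R ps a b vs"
      show "P y"
      proof (cases "lower R y")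
        case True
        from y obtain v us where vs: "vs = v # us" and yy: "y = ps @ a # (b @ v) # us"
          by (cases vs) (auto split: if_splits)
        from True obtain d where "matched R d y" by (auto simp: lower_def)
        then obtain ps' a' b' ws where y': "y = ps' @ (a' @ b') # ws" and d: "d = ps' @ a' # b' # ws"
          "is_chain R (ps' @ [a'])" "b' \<noteq> []" "normal R (a' @ b')" "bar_term R d"
          by (rule matchedE)
        have "length ps < length ps'"
          using is_chain_split_less[OF d(2,3) _ less.prems(2), of ws "(b @ v) # us"] y' yy by simp
        moreover have "length (ps @ a # (b @ v) # us) = length (ps' @ (a' @ b') # ws)"
          using y' yy by simp
        ultimately have "length ws < length vs" by (simp add: vs)
        then show "P y" unfolding y' using less.hyps d by blast
      qed (rule not_lower)
    qed
  qed
  show ?thesis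
  proof (cases "lower R c")
    case True
    then show ?thesis using main by (auto simp: lower_def elim!: matchedE)
  qed (rule not_lower)
qed

lemma finite_paths:
  assumes "target R (length c) e"
  shows "finite (paths (GM_weight R :: _ \<Rightarrow> _ \<Rightarrow> 'k::field) c e)"
  using assms
proof (induction c rule: greedy_induct[of R])
  case (1 c)
  then show ?case by (simp add: paths_not_lower)
next
  case (2 ps a b vs)
  show ?case
  proof (rule finite_paths_onward[OF 2(1-3,5)])
    fix y assume "y \<in> onward R ps a b vs"
    then show "finite (paths (GM_weight R :: _ \<Rightarrow> _ \<Rightarrow> 'k) y e)"
      using 2(4,5) GM_weight_down(2)[OF 2(1-3)] by simp
  qed
qed

lemma Theta_split:
  assumes "bar_term R (ps @ a # b # vs)" "is_chain R (ps @ [a])" "normal R (a @ b)"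
    and "target R (length ps + length vs + 1) e"
  shows "(Theta R (ps @ (a @ b) # vs) e :: 'k::field) =
    (if ps @ a # b # vs = e then (-1) ^ (length ps + 1) else 0) + (\<Sum>y\<in>onward R ps a b vs. Theta R y e)"
proof (rule Theta_onward[OF assms(1-3)])
  show t: "target R (length (ps @ (a @ b) # vs)) e" using assms(4) by simp
  fix y assume "y \<in> onward R ps a b vs"
  then have "length y = length (ps @ (a @ b) # vs)" by (rule GM_weight_down(2)[OF assms(1-3)])
  then show "finite (paths (GM_weight R :: _ \<Rightarrow> _ \<Rightarrow> 'k) y e)" using t by (intro finite_paths) simp
qed

text \<open>Without this, \<^const>\<open>Sum_any\<close> in the definitions of \<open>h\<close> and \<open>p\<close> would be zero by default.\<close>

lemma finite_Theta_support:
  "finite {e. target R (length c) e \<and> (Theta R c e :: 'k::field) \<noteq> 0}"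
proof (induction c rule: greedy_induct[of R])
  case (1 c)
  then have "{e. target R (length c) e \<and> (Theta R c e :: 'k) \<noteq> 0} \<subseteq> {c}"
    by (auto simp: Theta_not_lower split: if_splits)
  then show ?case by (rule finite_subset) simp
next
  case (2 ps a b vs)
  let ?S = "\<lambda>c. {e. target R (length c) e \<and> (Theta R c e :: 'k) \<noteq> 0}"
  have "?S (ps @ (a @ b) # vs) \<subseteq> insert (ps @ a # b # vs) (\<Union>y\<in>onward R ps a b vs. ?S y)"
  proof
    fix e assume e: "e \<in> ?S (ps @ (a @ b) # vs)"
    then have t: "target R (length ps + length vs + 1) e" by simp
    show "e \<in> insert (ps @ a # b # vs) (\<Union>y\<in>onward R ps a b vs. ?S y)"
    proof (cases "\<exists>y\<in>onward R ps a b vs. (Theta R y e :: 'k) \<noteq> 0")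
      case True
      then show ?thesis using t GM_weight_down(2)[OF 2(1-3)] by fastforce
    next
      case False
      then have "(\<Sum>y\<in>onward R ps a b vs. Theta R y e :: 'k) = 0" by (intro sum.neutral) blast
      then show ?thesis using e Theta_split[OF 2(1-3) t, where 'k='k] by (auto split: if_splits)
    qed
  qed
  moreover have "finite (onward R ps a b vs)" using onward_cases[OF 2(1-3)] by (metis finite.emptyI finite.insertI)
  ultimately show ?case using 2(4) by (meson finite_UN_I finite_insert finite_subset)
qed

lemma lookup_Sum_any_single:
  fixes f :: "'b \<Rightarrow> 'k::field"
  assumes "finite {e. f e \<noteq> 0}"
  shows "Poly_Mapping.lookup (Sum_any (\<lambda>e. Poly_Mapping.single e (f e))) x = f x"
proof -
  have [simp]: "Poly_Mapping.single e (f e) = 0 \<longleftrightarrow> f e = 0" for e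
    by (metis lookup_single_eq lookup_zero single_zero)
  have "Poly_Mapping.lookup (Sum_any (\<lambda>e. Poly_Mapping.single e (f e))) x =
    (\<Sum>e | f e \<noteq> 0. if e = x then f x else 0)"
    unfolding Sum_any.expand_set lookup_sum
    by (intro sum.cong) (auto simp: lookup_single when_def)
  also have "\<dots> = f x" using assms by (simp add: sum.delta')
  finally show ?thesis .
qed

lemma lookup_htpy:
  "Poly_Mapping.lookup (htpy R c :: _ \<Rightarrow>\<^sub>0 'k::field) e =
    (if bar_term R e \<and> length e = length c + 1 then Theta R c e else 0)"
proof -
  let ?f = "\<lambda>e. if bar_term R e \<and> length e = length c + 1 then Theta R c e else 0 :: 'k"
  have *: "htpy R c = Sum_any (\<lambda>e. Poly_Mapping.single e (?f e))"
    unfolding htpy_def by (rule arg_cong[of _ _ Sum_any]) auto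
  have "finite {e. ?f e \<noteq> 0}"
    by (rule finite_subset[OF _ finite_Theta_support[of R c, where 'k='k]]) (auto simp: target_def)
  then show ?thesis unfolding * by (rule lookup_Sum_any_single)
qed

lemma lookup_proj:
  "Poly_Mapping.lookup (proj R c :: _ \<Rightarrow>\<^sub>0 'k::field) e =
    (if is_chain R e \<and> length e = length c then Theta R c e else 0)"
proof -
  let ?f = "\<lambda>e. if is_chain R e \<and> length e = length c then Theta R c e else 0 :: 'k"
  have *: "proj R c = Sum_any (\<lambda>e. Poly_Mapping.single e (?f e))"
    unfolding proj_def by (rule arg_cong[of _ _ Sum_any]) (auto simp: is_chain_def)
  have "finite {e. ?f e \<noteq> 0}"
    by (rule finite_subset[OF _ finite_Theta_support[of R c, where 'k='k]]) (auto simp: target_def)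
  then show ?thesis unfolding * by (rule lookup_Sum_any_single)
qed

lemma htpy_not_lower: "\<not> lower R c \<Longrightarrow> htpy R c = 0"
  by (rule poly_mapping_eqI) (auto simp: lookup_htpy Theta_not_lower target_def)

lemma proj_not_lower: "\<not> lower R c \<Longrightarrow> proj R c = (if is_chain R c then Poly_Mapping.single c 1 else 0)"
  by (rule poly_mapping_eqI) (auto simp: lookup_proj Theta_not_lower target_def lookup_single when_def)

lemma htpy_split:
  assumes "bar_term R (ps @ a # b # vs)" "is_chain R (ps @ [a])" "normal R (a @ b)"
  shows "(htpy R (ps @ (a @ b) # vs) :: _ \<Rightarrow>\<^sub>0 'k::field) =
    Poly_Mapping.single (ps @ a # b # vs) ((-1) ^ (length ps + 1)) + (\<Sum>y\<in>onward R ps a b vs. htpy R y)"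
proof (rule poly_mapping_eqI)
  fix e
  have l: "length y = length (ps @ (a @ b) # vs)" if "y \<in> onward R ps a b vs" for y
    by (rule GM_weight_down(2)[OF assms that])
  show "Poly_Mapping.lookup (htpy R (ps @ (a @ b) # vs)) e = Poly_Mapping.lookup
    (Poly_Mapping.single (ps @ a # b # vs) ((-1) ^ (length ps + 1)) + (\<Sum>y\<in>onward R ps a b vs. htpy R y :: _ \<Rightarrow>\<^sub>0 'k)) e"
  proof (cases "bar_term R e \<and> length e = length ps + length vs + 2")
    case True
    then have "target R (length ps + length vs + 1) e" by (simp add: target_def)
    from Theta_split[OF assms this, where 'k='k] True show ?thesis
      by (simp add: lookup_add lookup_sum lookup_htpy lookup_single when_def l cong: sum.cong)
  next
    case False
    then have "ps @ a # b # vs \<noteq> e" using assms(1) by auto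
    then show ?thesis using False
      by (auto simp: lookup_add lookup_sum lookup_htpy lookup_single when_def l cong: sum.cong)
  qed
qed

lemma proj_split:
  assumes "bar_term R (ps @ a # b # vs)" "is_chain R (ps @ [a])" "normal R (a @ b)"
  shows "(proj R (ps @ (a @ b) # vs) :: _ \<Rightarrow>\<^sub>0 'k::field) = (\<Sum>y\<in>onward R ps a b vs. proj R y)"
proof (rule poly_mapping_eqI)
  fix e
  have l: "length y = length (ps @ (a @ b) # vs)" if "y \<in> onward R ps a b vs" for y
    by (rule GM_weight_down(2)[OF assms that])
  show "Poly_Mapping.lookup (proj R (ps @ (a @ b) # vs)) e = Poly_Mapping.lookup
    (\<Sum>y\<in>onward R ps a b vs. proj R y :: _ \<Rightarrow>\<^sub>0 'k) e"
  proof (cases "is_chain R e \<and> length e = length ps + length vs + 1")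
    case True
    then have "target R (length ps + length vs + 1) e" "ps @ a # b # vs \<noteq> e" by (auto simp: target_def)
    with Theta_split[OF assms this(1), where 'k='k] True show ?thesis
      by (simp add: lookup_sum lookup_proj l cong: sum.cong)
  next
    case False
    then show ?thesis by (auto simp: lookup_sum lookup_proj l cong: sum.cong)
  qed
qed

section \<open>Tensor powers and the transferred operations\<close>

lemma scale_0 [simp]: "scale a 0 = 0" "scale 0 x = 0"
  by (rule poly_mapping_eqI; simp)+

lemma scale_1 [simp]: "scale 1 x = x"
  by (rule poly_mapping_eqI) simp

lemma scale_scale: "scale a (scale b x) = scale (a * b) x"
  by (rule poly_mapping_eqI) (simp add: mult.assoc)

lemma scale_add_left: "scale (a + b) x = scale a x + scale b x"
  by (rule poly_mapping_eqI) (simp add: lookup_add distrib_right)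

lemma scale_sum_right: "scale a (sum f S) = (\<Sum>i\<in>S. scale a (f i))"
  by (rule poly_mapping_eqI) (simp add: lookup_sum sum_distrib_left)

lemma lin_superset:
  assumes "finite S" "Poly_Mapping.keys x \<subseteq> S"
  shows "lin f x = (\<Sum>b\<in>S. scale (Poly_Mapping.lookup x b) (f b))"
  unfolding lin_def using assms by (intro sum.mono_neutral_left) (auto simp: in_keys_iff)

lemma lin_0 [simp]: "lin f 0 = 0"
  by (simp add: lin_def)

lemma lin_add: "lin f (x + y) = lin f x + lin f y"
proof -
  let ?S = "Poly_Mapping.keys x \<union> Poly_Mapping.keys y"
  have "lin f z = (\<Sum>b\<in>?S. scale (Poly_Mapping.lookup z b) (f b))"
    if "Poly_Mapping.keys z \<subseteq> ?S" for z
    using that by (intro lin_superset) auto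
  from this[of x] this[of y] this[of "x + y"] show ?thesis
    using Poly_Mapping.keys_add[of x y] by (simp add: lookup_add scale_add_left sum.distrib)
qed

lemma lin_scale: "lin f (scale a x) = scale a (lin f x)"
  by (subst lin_superset[OF finite_keys keys_scale])
    (simp add: lin_def scale_sum_right scale_scale)

lemma lin_sum: "lin f (sum g S) = (\<Sum>i\<in>S. lin f (g i))"
  by (induction S rule: infinite_finite_induct) (auto simp: lin_add)

lemma lin_lin: "lin f (lin g x) = lin (\<lambda>b. lin f (g b)) x"
  unfolding lin_def[of g] lin_sum lin_scale by (simp add: lin_def)

lemma lin_swap: "lin (\<lambda>u. lin (F u) y) x = lin (\<lambda>v. lin (\<lambda>u. F u v) x) y"
  unfolding lin_def scale_sum_right scale_scale
  by (subst sum.swap) (simp add: mult.commute)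

lemma lin_single_self: "lin (\<lambda>v. Poly_Mapping.single v 1) y = y"
  by (rule poly_mapping_eqI) (simp add: lin_def lookup_sum lookup_single when_def in_keys_iff)

lemma lin_const_0 [simp]: "lin (\<lambda>v. 0) y = 0"
  by (simp add: lin_def)

lemma tens_lin_left: "tens (lin f x) y = lin (\<lambda>u. tens (f u) y) x"
  by (simp add: tens_def lin_lin)

lemma tens_lin_right: "tens x (lin f y) = lin (\<lambda>v. tens x (f v)) y"
  unfolding tens_def lin_lin by (rule lin_swap)

lemma tens_0_left [simp]: "tens 0 y = 0"
  by (simp add: tens_def)

lemma tens_0_right [simp]: "tens x 0 = 0"
  by (simp add: tens_def)

lemma tens_Nil_left [simp]: "tens (Poly_Mapping.single [] 1) y = y"
  by (simp add: tens_def lin_single_self)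

lemma tens_Nil_right [simp]: "tens x (Poly_Mapping.single [] 1) = x"
  by (simp add: tens_def lin_single_self)

lemma tens_assoc: "tens (tens x y) z = tens x (tens y z)"
  unfolding tens_def lin_lin by simp

lemma tensor_power_append:
  "tensor_power f (u @ v) = tens (tensor_power f u) (tensor_power f v)"
  by (induction u) (simp_all add: tens_assoc)

text \<open>The map \<open>p\<^bsup>\<otimes>n\<^esup>\<close> is multiplicative for the concatenation of tensor words, so it can be pushed into the two
factors of each summand of the recursion for \<open>\<Delta>'\<^sub>n\<close>.\<close>

lemma lin_tensor_power_tens:
  "lin (tensor_power f) (tens x y) = tens (lin (tensor_power f) x) (lin (tensor_power f) y)"
proof -
  have "lin (tensor_power f) (tens x y) = lin (\<lambda>u. lin (\<lambda>v. tensor_power f (u @ v)) y) x"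
    by (simp add: tens_def lin_lin)
  also have "\<dots> = tens (lin (tensor_power f) x) (lin (tensor_power f) y)"
    by (simp add: tensor_power_append tens_lin_left tens_lin_right, rule lin_swap)
  finally show ?thesis .
qed

lemma lookup_tens_single:
  "Poly_Mapping.lookup (tens (Poly_Mapping.single [g] 1) y :: 'b list \<Rightarrow>\<^sub>0 'k::field) \<Gamma> =
    (if \<Gamma> \<noteq> [] \<and> hd \<Gamma> = g then Poly_Mapping.lookup y (tl \<Gamma>) else 0)"
proof -
  have "Poly_Mapping.lookup (tens (Poly_Mapping.single [g] 1) y :: 'b list \<Rightarrow>\<^sub>0 'k) \<Gamma> =
    (\<Sum>v\<in>Poly_Mapping.keys y. if g # v = \<Gamma> then Poly_Mapping.lookup y v else 0)"
    by (simp add: tens_def lin_def lookup_sum lookup_single when_def if_distrib cong: if_cong)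
  also have "\<dots> = (if \<Gamma> \<noteq> [] \<and> hd \<Gamma> = g then Poly_Mapping.lookup y (tl \<Gamma>) else 0)"
    by (cases \<Gamma>) (auto simp: in_keys_iff)
  finally show ?thesis .
qed

text \<open>These are \<open>p\<^bsup>\<otimes>n\<^esup> \<Delta>'\<^sub>n\<close> and \<open>p\<^bsup>\<otimes>m\<^esup> \<Delta>'\<^sub>m h\<close> on bar terms.  By the convention for \<open>\<Delta>'\<^sub>1 h\<close>, the second map is \<open>p\<close> for
\<open>m = 1\<close>, so that one recursion covers \<open>p\<close> and all higher operations.\<close>

definition transfer :: "'x list set \<Rightarrow> nat \<Rightarrow> 'x list list \<Rightarrow> ('x list list list \<Rightarrow>\<^sub>0 'k::field)" where
  "transfer R n d = lin (tensor_power (proj R)) (Delta' R n d)"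

definition transfer_h :: "'x list set \<Rightarrow> nat \<Rightarrow> 'x list list \<Rightarrow> ('x list list list \<Rightarrow>\<^sub>0 'k::field)" where
  "transfer_h R m c = lin (tensor_power (proj R)) (after_h R m (Delta' R m) c)"

lemma transfer_h_1: "transfer_h R (Suc 0) c = lin (\<lambda>a. Poly_Mapping.single [a] 1) (proj R c)"
  by (simp add: transfer_h_def after_h_def)

lemma transfer_h_ge_2: "m \<ge> 2 \<Longrightarrow> transfer_h R m c = lin (transfer R m) (htpy R c)"
  by (simp add: transfer_h_def after_h_def lin_lin transfer_def[abs_def])

lemma Delta_eq_transfer: "Delta R n \<gamma> = transfer R n \<gamma>"
  by (simp add: Delta_def transfer_def incl_def)

text \<open>The map \<open>h\<close> vanishes on vertices that are not lower, so only \<open>\<Delta>'\<^sub>1 h = 1\<close> is possible in the first tensor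
factor.  The sign collects \<open>(-1)\<^sup>n\<close> from the recursion and \<open>(-1)\<^bsup>(n - 2) i\<^esup>\<close> from the Koszul rule.\<close>

lemma transfer_not_lower_prefixes:
  assumes n: "n \<ge> 2" and nl: "\<And>i. 1 \<le> i \<Longrightarrow> i < length d \<Longrightarrow> \<not> lower R (take i d)"
  shows "(transfer R n d :: _ \<Rightarrow>\<^sub>0 'k::field) = (\<Sum>i\<in>{1..<length d}. if is_chain R (take i d)
    then scale ((-1) ^ (n * (i + 1))) (tens (Poly_Mapping.single [take i d] 1) (transfer_h R (n - 1) (drop i d)))
    else 0)"
    (is "_ = (\<Sum>i\<in>?I. ?t i)")
proof -
  let ?P = "lin (tensor_power (proj R)) :: _ \<Rightarrow> _ \<Rightarrow>\<^sub>0 'k"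
  have sing: "tens (lin (\<lambda>a. Poly_Mapping.single [a] 1) (proj R (take i d))) y =
      (if is_chain R (take i d) then tens (Poly_Mapping.single [take i d] 1) y else 0)"
    if "i \<in> ?I" for i and y :: "_ \<Rightarrow>\<^sub>0 'k"
    using that nl by (simp add: proj_not_lower)
  consider "n = 2" | "n > 2" using n by linarith
  then show ?thesis
  proof cases
    case 1
    have "transfer R n d = (\<Sum>i\<in>?I. ?P (Poly_Mapping.single [take i d, drop i d] 1))"
      by (simp add: 1 transfer_def Delta'.simps bar_coproduct_def lin_sum)
    also have "\<dots> = (\<Sum>i\<in>?I. ?t i)"
    proof (rule sum.cong[OF refl])
      fix i assume "i \<in> ?I"
      from sing[OF this] show "?P (Poly_Mapping.single [take i d, drop i d] 1) = ?t i"
        by (simp add: 1 transfer_h_1 power_mult)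
    qed
    finally show ?thesis .
  next
    case 2
    let ?K = "\<lambda>s i. koszul_tensor (n - s - 1) (after_h R s (Delta' R s))
        (after_h R (n - s) (Delta' R (n - s))) [take i d, drop i d] :: _ \<Rightarrow>\<^sub>0 'k"
    have "transfer R n d = ?P (\<Sum>s\<in>{1..<n}. scale ((-1) ^ (s * (n - s + 1)))
             (lin (koszul_tensor (n - s - 1) (after_h R s (Delta' R s)) (after_h R (n - s) (Delta' R (n - s))))
                  (bar_coproduct d)))"
      using 2 unfolding transfer_def by (subst Delta'.simps) simp
    also have "\<dots> = (\<Sum>s\<in>{1..<n}. \<Sum>i\<in>?I. scale ((-1) ^ (s * (n - s + 1))) (?P (?K s i)))"
      by (simp add: bar_coproduct_def lin_sum lin_scale scale_sum_right)
    also have "\<dots> = (\<Sum>i\<in>?I. \<Sum>s\<in>{1..<n}. scale ((-1) ^ (s * (n - s + 1))) (?P (?K s i)))"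
      by (rule sum.swap)
    also have "\<dots> = (\<Sum>i\<in>?I. ?t i)"
    proof (rule sum.cong[OF refl])
      fix i assume i: "i \<in> ?I"
      have "?K s i = 0" if "s \<in> {1..<n} - {1}" for s
        using that i nl by (auto simp: koszul_tensor_def after_h_def htpy_not_lower)
      then have "(\<Sum>s\<in>{1..<n}. scale ((-1) ^ (s * (n - s + 1))) (?P (?K s i))) =
        (\<Sum>s\<in>{1}. scale ((-1) ^ (s * (n - s + 1))) (?P (?K s i)))"
        using 2 by (intro sum.mono_neutral_right) auto
      also have "\<dots> = scale ((-1) ^ n * (-1) ^ ((n - 2) * i))
          (tens (lin (\<lambda>a. Poly_Mapping.single [a] 1) (proj R (take i d))) (transfer_h R (n - 1) (drop i d)))"
        using i 2 by (simp add: koszul_tensor_def after_h_def[of _ "Suc 0"] lin_scale scale_scale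
            lin_tensor_power_tens transfer_h_def min_def numeral_2_eq_2)
      also have "(-1) ^ n * (-1) ^ ((n - 2) * i) = ((-1) ^ (n * (i + 1)) :: 'k)"
      proof -
        obtain k where "n = k + 2" using n by (metis add.commute le_Suc_ex)
        then show ?thesis by (simp add: power_add algebra_simps power_mult)
      qed
      finally show "(\<Sum>s\<in>{1..<n}. scale ((-1) ^ (s * (n - s + 1))) (?P (?K s i))) = ?t i"
        by (simp only: sing[OF i] if_distrib[of "scale _"] scale_0)
    qed
    finally show ?thesis .
  qed
qed

section \<open>Greedy cuts\<close>

lemma normal_appendD: "normal R (u @ v) \<Longrightarrow> normal R u" "normal R (u @ v) \<Longrightarrow> normal R v"
  using not_normal_append by blast+

lemma bar_term_append:
  "bar_term R (ps @ qs) \<longleftrightarrow> ps @ qs \<noteq> [] \<and> (\<forall>u\<in>set ps. u \<noteq> [] \<and> normal R u) \<and> (\<forall>u\<in>set qs. u \<noteq> [] \<and> normal R u)"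
  by (auto simp: bar_term_def)

lemma zero_minimallyD:
  assumes "zero_minimally R u v"
  shows "u \<noteq> []" "v \<noteq> []" "normal R u" "normal R v" "\<not> normal R (u @ v)"
    "strict_prefix p v \<Longrightarrow> normal R (u @ p)"
  using assms by (auto simp: zero_minimally_def)

lemma is_chain_snoc: "is_chain R (ps @ [x]) \<Longrightarrow> zero_minimally R x y \<Longrightarrow> is_chain R (ps @ [x, y])"
  using successively_append_iff[of "zero_minimally R" "ps @ [x]" "[y]"]
  by (cases ps) (auto simp: is_chain_iff bar_term_def dest: zero_minimallyD)

lemma zero_minimally_suffix:
  assumes "zero_minimally R (u @ v) w" "v \<noteq> []" "\<not> normal R (v @ w)"
  shows "zero_minimally R v w"
  using assms normal_appendD(2)[of R u] by (simp add: zero_minimally_def)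

text \<open>A proper prefix of \<open>v @ w\<close> is either a prefix of \<open>v\<close> or consists of \<open>v\<close> and a proper prefix of \<open>w\<close>, so \<open>v\<close> can be moved
to the right factor.\<close>

lemma zero_minimally_shift:
  assumes "zero_minimally R (u @ v) w" "u \<noteq> []" "normal R (v @ w)"
  shows "zero_minimally R u (v @ w)"
  unfolding zero_minimally_def
proof (intro conjI allI impI)
  show "u \<noteq> []" "v @ w \<noteq> []" "normal R u" "normal R (v @ w)" "\<not> normal R (u @ v @ w)"
    using assms normal_appendD(1) by (auto simp: zero_minimally_def)
  fix p assume p: "strict_prefix p (v @ w)"
  show "normal R (u @ p)"
  proof (cases "prefix p v")
    case True
    then obtain t where "v = p @ t" by (auto simp: prefix_def)
    then show ?thesis using assms(1) normal_appendD(1)[of R "u @ p" t] by (simp add: zero_minimally_def)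
  next
    case False
    then obtain q where q: "p = v @ q" using p by (auto simp: strict_prefix_def prefix_append)
    then have "strict_prefix q w" using p by (simp add: strict_prefix_def)
    then show ?thesis using assms(1) q by (simp add: zero_minimally_def)
  qed
qed

lemma zero_minimally_exists:
  assumes "u \<noteq> []" "normal R u" "normal R v" "\<not> normal R (u @ v)"
  shows "\<exists>a b. v = a @ b \<and> zero_minimally R u a"
proof -
  define k where "k = (LEAST k. \<not> normal R (u @ take k v))"
  have 1: "\<not> normal R (u @ take k v)"
    unfolding k_def by (rule LeastI[of _ "length v"]) (simp add: assms)
  have "zero_minimally R u (take k v)"
    unfolding zero_minimally_def
  proof (intro conjI allI impI)
    show "take k v \<noteq> []" using 1 assms(2) by (metis append_Nil2)
    show "normal R (take k v)" using assms(3) normal_appendD(1)[of R "take k v" "drop k v"] by simp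
    fix p assume p: "strict_prefix p (take k v)"
    then have "length p < length (take k v)" by (rule prefix_length_less)
    then have "length p < k" by simp
    moreover have "p = take (length p) v"
      using p by (metis append_eq_conv_conj prefix_def strict_prefix_def take_is_prefix prefix_order.trans)
    ultimately show "normal R (u @ p)" using not_less_Least[of "length p"] unfolding k_def by metis
  qed (use assms 1 in auto)
  then show ?thesis by (metis append_take_drop_id)
qed

text \<open>With \<open>b = []\<close> the bar \<open>v\<close> itself continues the chain; otherwise \<open>v\<close> is the bar that is cut.\<close>

lemma greedy_bar:
  assumes "ps \<noteq> [] \<Longrightarrow> is_chain R ps" "ps \<noteq> [] \<Longrightarrow> \<not> normal R (last ps @ v)" "v \<noteq> []" "normal R v"
  obtains a b where "v = a @ b" "is_chain R (ps @ [a])"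
proof (cases ps rule: rev_cases)
  case Nil
  obtain x xs where "v = [x] @ xs" using assms(3) by (cases v) auto
  moreover from this have "is_chain R (ps @ [[x]])"
    using assms(4) normal_appendD(1)[of R "[x]" xs] Nil by (simp add: is_chain_iff bar_term_def)
  ultimately show ?thesis using that by blast
next
  case (snoc qs u)
  then have "is_chain R (qs @ [u])" using assms(1) by simp
  moreover from this have "u \<noteq> []" "normal R u" by (auto simp: is_chain_iff bar_term_def)
  moreover have "\<not> normal R (u @ v)" using assms(2) snoc by simp
  ultimately obtain a b where "v = a @ b" "zero_minimally R u a"
    using zero_minimally_exists[of u R v] assms(4) by blast
  then show ?thesis using that is_chain_snoc[of R qs u a] \<open>is_chain R (qs @ [u])\<close> snoc by simp
qed

lemma upperI: "is_chain R (ps @ [a]) \<Longrightarrow> normal R (a @ b) \<Longrightarrow> bar_term R (ps @ a # b # vs) \<Longrightarrow> upper R (ps @ a # b # vs)"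
  by (auto simp: upper_iff)

lemma transfer_h_upper:
  assumes "upper R c" "m \<ge> 1"
  shows "(transfer_h R m c :: _ \<Rightarrow>\<^sub>0 'k::field) = 0"
proof -
  have nl: "\<not> lower R c" using assms not_upper_and_lower by blast
  have "\<not> is_chain R c" using assms is_chain_not_upper by blast
  then show ?thesis using nl assms(2) transfer_h_ge_2[of m R c]
    by (cases "m = 1") (auto simp: transfer_h_1 proj_not_lower htpy_not_lower)
qed

lemma transfer_h_chain:
  assumes "is_chain R c" "m \<ge> 1"
  shows "(transfer_h R m c :: _ \<Rightarrow>\<^sub>0 'k::field) = (if m = 1 then Poly_Mapping.single [c] 1 else 0)"
  using assms transfer_h_ge_2[of m R c] is_chain_not_lower[OF assms(1)]
  by (cases "m = 1") (auto simp: transfer_h_1 proj_not_lower htpy_not_lower)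

lemma transfer_h_split:
  assumes "bar_term R (ps @ a # b # vs)" "is_chain R (ps @ [a])" "normal R (a @ b)" "m \<ge> 1"
  shows "(transfer_h R m (ps @ (a @ b) # vs) :: _ \<Rightarrow>\<^sub>0 'k::field) =
    (if m = 1 then 0 else scale ((-1) ^ (length ps + 1)) (transfer R m (ps @ a # b # vs))) +
    (\<Sum>y\<in>onward R ps a b vs. transfer_h R m y)"
proof (cases "m = 1")
  case True
  then show ?thesis by (simp add: transfer_h_1 proj_split[OF assms(1-3)] lin_sum)
next
  case False
  then show ?thesis using assms(4)
    by (simp add: transfer_h_ge_2 htpy_split[OF assms(1-3)] lin_sum lin_add)
qed

text \<open>A prefix that contains both pieces of the cut bar is upper, and \<open>h\<close> and \<open>p\<close> vanish on it.  So the bar term is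
split only at the boundaries of its initial chain.\<close>

lemma transfer_split:
  assumes "bar_term R (ps @ a # b # vs)" "is_chain R (ps @ [a])" "normal R (a @ b)" "n \<ge> 2"
  shows "(transfer R n (ps @ a # b # vs) :: _ \<Rightarrow>\<^sub>0 'k::field) = (\<Sum>i\<in>{1..length ps + 1}.
    scale ((-1) ^ (n * (i + 1))) (tens (Poly_Mapping.single [take i (ps @ a # b # vs)] 1)
      (transfer_h R (n - 1) (drop i (ps @ a # b # vs)))))"
proof -
  let ?d = "ps @ a # b # vs"
  have short: "is_chain R (take i ?d)" if "1 \<le> i" "i \<le> length ps + 1" for i
  proof -
    have "take i ?d = take i (ps @ [a])" using that by (cases "i = length ps + 1") auto
    moreover have "is_chain R (take i (ps @ [a]))"
      using assms(2) that is_chain_prefix[of R "take i (ps @ [a])" "drop i (ps @ [a])"]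
      unfolding append_take_drop_id by simp
    ultimately show ?thesis by simp
  qed
  have long: "upper R (take i ?d)" if "length ps + 1 < i" for i
  proof -
    have "length ps + 2 \<le> i" using that by simp
    then obtain k where k: "i = length ps + 2 + k" by (rule less_eqE)
    have "take i ?d = ps @ a # b # take k vs" by (simp add: k)
    moreover have "bar_term R (ps @ a # b # take k vs)"
      using assms(1) by (auto simp: bar_term_def dest: in_set_takeD)
    ultimately show ?thesis using upperI[OF assms(2,3)] by simp
  qed
  have "transfer R n ?d = (\<Sum>i\<in>{1..<length ?d}. if is_chain R (take i ?d)
    then scale ((-1) ^ (n * (i + 1))) (tens (Poly_Mapping.single [take i ?d] 1) (transfer_h R (n - 1) (drop i ?d)))
    else 0 :: _ \<Rightarrow>\<^sub>0 'k)"
  proof (rule transfer_not_lower_prefixes[OF assms(4)])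
    fix i :: nat assume "1 \<le> i"
    then show "\<not> lower R (take i ?d)"
      using short[of i] long[of i] is_chain_not_lower not_upper_and_lower by (metis not_le)
  qed
  also have "\<dots> = (\<Sum>i\<in>{1..length ps + 1}. if is_chain R (take i ?d)
    then scale ((-1) ^ (n * (i + 1))) (tens (Poly_Mapping.single [take i ?d] 1) (transfer_h R (n - 1) (drop i ?d)))
    else 0)"
    using long is_chain_not_upper by (intro sum.mono_neutral_right) fastforce+
  also have "\<dots> = (\<Sum>i\<in>{1..length ps + 1}. 
    scale ((-1) ^ (n * (i + 1))) (tens (Poly_Mapping.single [take i ?d] 1) (transfer_h R (n - 1) (drop i ?d))))"
    using short by (intro sum.cong) auto
  finally show ?thesis .
qed

lemma transfer_chain:
  assumes "is_chain R c" "n \<ge> 2"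
  shows "(transfer R n c :: _ \<Rightarrow>\<^sub>0 'k::field) = (\<Sum>i\<in>{1..<length c}.
    scale ((-1) ^ (n * (i + 1))) (tens (Poly_Mapping.single [take i c] 1) (transfer_h R (n - 1) (drop i c))))"
proof -
  have *: "is_chain R (take i c)" if "1 \<le> i" "i < length c" for i
    using assms(1) that is_chain_prefix[of R "take i c" "drop i c"] by fastforce
  then have "\<not> lower R (take i c)" if "1 \<le> i" "i < length c" for i
    using that is_chain_not_lower by blast
  from transfer_not_lower_prefixes[OF assms(2) this, where 'k='k] show ?thesis
    using * by (simp only:) (intro sum.cong, auto)
qed

section \<open>Defective bar terms\<close>

text \<open>The bars are grouped into pairs from the left, and the first pair that does not vanish minimally has
a nonzero product.\<close>

fun defective :: "'x list set \<Rightarrow> 'x list list \<Rightarrow> bool" where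
  "defective R (a # b # vs) \<longleftrightarrow> normal R (a @ b) \<or> zero_minimally R a b \<and> defective R vs"
| "defective R _ \<longleftrightarrow> False"

lemma defective_append:
  "successively (zero_minimally R) us \<Longrightarrow> even (length us) \<Longrightarrow> defective R vs \<Longrightarrow> defective R (us @ vs)"
proof (induction us rule: induct_list012)
  case (3 x y zs)
  then show ?case by (cases zs) auto
qed auto

lemma successively_drop: "successively P xs \<Longrightarrow> successively P (drop i xs)"
  using successively_append_iff[of P "take i xs" "drop i xs"] by simp

text \<open>Dropping greedy bars shifts the pairing.  If the cut falls inside a pair, then this pair is \<open>(a, b)\<close>, whose product
is nonzero; otherwise the pairing of the bars behind the cut decides.\<close>

lemma defective_drop:
  assumes "is_chain R (ps @ [a])" "normal R (a @ b)" "i \<le> length ps + 1"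
    and "even (length ps + 1 - i) \<Longrightarrow> defective R (b # vs)"
  shows "defective R (drop i (ps @ a # b # vs))"
proof (cases "even (length ps + 1 - i)")
  case True
  have "drop i (ps @ a # b # vs) = drop i (ps @ [a]) @ b # vs"
    using assms(3) by (cases "i = length ps + 1") auto
  moreover have "even (length (drop i (ps @ [a])))" using True by (simp only: length_drop length_append) simp
  ultimately show ?thesis using True assms(4) successively_drop[OF is_chainD(3)[OF assms(1)], of i]
    by (simp only: defective_append)
next
  case False
  then have i: "i \<le> length ps" using assms(3) by (cases "i = length ps + 1") auto
  have "successively (zero_minimally R) ps"
    using is_chainD(3)[OF assms(1)] by (simp add: successively_append_iff)
  then have "defective R (drop i ps @ a # b # vs)"
    using False i assms(2) by (intro defective_append successively_drop) (auto simp: Suc_diff_le)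
  then show ?thesis using i by simp
qed

lemma bar_term_drop: "bar_term R d \<Longrightarrow> i < length d \<Longrightarrow> bar_term R (drop i d)"
  by (auto simp: bar_term_def dest: in_set_dropD)

lemma transfer_defective:
  assumes "bar_term R (ps @ a # b # vs)" "is_chain R (ps @ [a])" "normal R (a @ b)" "n \<ge> 2"
    and d: "defective R (b # vs)"
    and IH: "\<And>c. bar_term R c \<Longrightarrow> defective R c \<Longrightarrow> (transfer_h R (n - 1) c :: _ \<Rightarrow>\<^sub>0 'k::field) = 0"
  shows "(transfer R n (ps @ a # b # vs) :: _ \<Rightarrow>\<^sub>0 'k) = 0"
proof -
  let ?d = "ps @ a # b # vs"
  have "(transfer_h R (n - 1) (drop i ?d) :: _ \<Rightarrow>\<^sub>0 'k) = 0" if "i \<in> {1..length ps + 1}" for i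
    using that assms by (intro IH bar_term_drop defective_drop) auto
  then show ?thesis
    unfolding transfer_split[OF assms(1-4)] by (intro sum.neutral) simp
qed

lemma defective_suffix:
  assumes "defective R ((a @ b) # v # vs)" "b \<noteq> []"
  shows "defective R (b # v # vs)"
proof (cases "normal R (b @ v)")
  case False
  then have "zero_minimally R (a @ b) v" "defective R vs"
    using assms normal_appendD(2)[of R a "b @ v"] by auto
  then show ?thesis using zero_minimally_suffix False assms(2) by auto
qed simp

text \<open>As long as the pairs vanish minimally, the greedy procedure preserves the ends of the pairs.  At the pair
\<open>(v, v')\<close> with nonzero product, cutting \<open>v = a b\<close> and moving onward yields \<open>a\<close> followed by \<open>b v'\<close> with
nonzero product, which is upper: no chain is reached.  All rests of the cut bar terms on the way
are defective again, which gives the claim for higher \<open>m\<close> by induction.\<close>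

lemma transfer_h_defective:
  assumes "m \<ge> 1" "bar_term R c" "defective R c"
  shows "(transfer_h R m c :: _ \<Rightarrow>\<^sub>0 'k::field) = 0"
  using assms
proof (induction m arbitrary: c)
  case 0
  then show ?case by simp
next
  case (Suc m)
  have IH: "(transfer_h R (Suc m - 1) c :: _ \<Rightarrow>\<^sub>0 'k) = 0" if "bar_term R c" "defective R c" "m \<ge> 1" for c
    using Suc.IH that by simp
  have "(transfer_h R (Suc m) (ps @ c) :: _ \<Rightarrow>\<^sub>0 'k) = 0"
    if "defective R c" "bar_term R (ps @ c)" "ps \<noteq> [] \<Longrightarrow> is_chain R ps" for ps
    using that
  proof (induction c arbitrary: ps rule: induct_list012)
    case (3 v v' vs)
    show ?case
    proof (cases "ps \<noteq> [] \<and> normal R (last ps @ v)")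
      case True
      then obtain qs u where "ps = qs @ [u]" by (metis rev_exhaust)
      then have "upper R (ps @ v # v' # vs)"
        using upperI[of R qs u v "v' # vs"] 3(4,5) True by simp
      then show ?thesis by (rule transfer_h_upper) simp
    next
      case False
      then obtain a b where v: "v = a @ b" and ch: "is_chain R (ps @ [a])"
        using greedy_bar[of ps R v] 3(4,5) by (auto simp: bar_term_append)
      show ?thesis
      proof (cases "b = []")
        case True
        show ?thesis
        proof (cases "normal R (v @ v')")
          case True
          then have "upper R (ps @ v # v' # vs)"
            using upperI[of R ps v v' vs] 3(4) ch v \<open>b = []\<close> by simp
          then show ?thesis by (rule transfer_h_upper) simp
        next
          case False
          then have "zero_minimally R v v'" "defective R vs" using 3(3) by auto
          moreover from this have "is_chain R (ps @ [v, v'])" using ch v \<open>b = []\<close> is_chain_snoc by simp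
          ultimately show ?thesis using 3(1)[of "ps @ [v, v']"] 3(4) False by simp
        qed
      next
        case False
        have nb: "normal R (a @ b)" using 3(4) v by (simp add: bar_term_append)
        have bt: "bar_term R (ps @ a # b # v' # vs)"
          using 3(4) v ch False normal_appendD[OF nb] by (auto simp: bar_term_append is_chain_iff)
        have db: "defective R (b # v' # vs)" using defective_suffix 3(3) v False by blast
        have "Suc m \<noteq> 1 \<Longrightarrow> (transfer R (Suc m) (ps @ a # b # v' # vs) :: _ \<Rightarrow>\<^sub>0 'k) = 0"
          using transfer_defective[OF bt ch nb _ db IH] by simp
        moreover have "(transfer_h R (Suc m) y :: _ \<Rightarrow>\<^sub>0 'k) = 0" if y: "y \<in> onward R ps a b (v' # vs)" for y
        proof -
          have n: "normal R (b @ v')" and y: "y = ps @ a # (b @ v') # vs"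
            using y by (auto split: if_splits)
          have bty: "bar_term R (ps @ a # (b @ v') # vs)" using bt n by (auto simp: bar_term_append)
          show ?thesis
          proof (cases "normal R (v @ v')")
            case True
            then have "upper R y" using upperI[OF ch, of "b @ v'" vs] bty y v by simp
            then show ?thesis by (rule transfer_h_upper) simp
          next
            case False
            then have z: "zero_minimally R (a @ b) v'" "defective R vs" using 3(3) v by auto
            then have "zero_minimally R a (b @ v')"
              using zero_minimally_shift n bt by (auto simp: bar_term_append)
            then have "is_chain R (ps @ [a, b @ v'])" using is_chain_snoc ch by blast
            then show ?thesis using 3(1)[of "ps @ [a, b @ v']"] z bty False by (simp add: y)
          qed
        qed
        ultimately show ?thesis using transfer_h_split[OF bt ch nb, of "Suc m", where 'k='k] v by simp
      qed
    qed
  qed auto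
  from this[of "[]"] show ?case using Suc.prems by simp
qed

section \<open>Tails of chains\<close>

text \<open>Write \<open>\<sigma>(x)\<close> for the first end of a relation that starts at position \<open>x\<close> of the word or later.  In the bar term
\<open>(a @ b) # vs\<close> the bars at even places carry a marker, the end of the part \<open>a\<close>.  The ends of the bars at odd
places are the iterates of \<open>\<sigma>\<close> from \<open>0\<close>, the markers are the iterates of \<open>\<sigma>\<close> from the first marker, and
both sequences interleave strictly.  A last bar at an even place ends at its marker.  The ends of the other
bars at even places lie anywhere between the marker and the next end at an odd place: they are what cutting
changes.\<close>

inductive interleaved :: "'x list set \<Rightarrow> 'x list \<Rightarrow> 'x list \<Rightarrow> 'x list list \<Rightarrow> bool" for R where
  end_even: "a \<noteq> [] \<Longrightarrow> interleaved R a [] []"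
| end_odd: "a \<noteq> [] \<Longrightarrow> zero_minimally R (a @ b) c \<Longrightarrow> normal R (b @ c) \<Longrightarrow> interleaved R a b [c]"
| step: "a \<noteq> [] \<Longrightarrow> zero_minimally R (a @ b) c \<Longrightarrow> zero_minimally R (b @ c) a' \<Longrightarrow>
    interleaved R a' b' vs \<Longrightarrow> interleaved R a b (c # (a' @ b') # vs)"

text \<open>Disjoint pairs of neighbours that vanish minimally; a last bar may remain single.\<close>

fun zero_pairs :: "'x list set \<Rightarrow> 'x list list \<Rightarrow> bool" where
  "zero_pairs R (a # b # vs) \<longleftrightarrow> zero_minimally R a b \<and> zero_pairs R vs"
| "zero_pairs R _ \<longleftrightarrow> True"

lemma interleaved_zero_pairs: "interleaved R a b vs \<Longrightarrow> zero_pairs R ((a @ b) # vs)"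
  by (induction rule: interleaved.induct) auto

definition interlaced :: "'x list set \<Rightarrow> 'x list list \<Rightarrow> bool" where
  "interlaced R c \<longleftrightarrow> (\<exists>a b vs. c = (a @ b) # vs \<and> interleaved R a b vs)"

text \<open>In a tail of a chain each marker is the end of its bar.\<close>

lemma successively_interlaced:
  "successively (zero_minimally R) c \<Longrightarrow> c \<noteq> [] \<Longrightarrow> hd c \<noteq> [] \<Longrightarrow> interlaced R c"
proof -
  have "interleaved R v [] vs" if "successively (zero_minimally R) (v # vs)" "v \<noteq> []" for v vs
    using that
  proof (induction vs arbitrary: v rule: induct_list012)
    case 1
    then show ?case by (intro end_even)
  next
    case (2 c)
    then show ?case by (intro end_odd) (auto dest: zero_minimallyD)
  next
    case (3 c v' vs)
    then have "interleaved R v' [] vs" by (auto dest: zero_minimallyD)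
    then show ?case using 3 step[of v R "[]" c v' "[]" vs] by auto
  qed
  then show "successively (zero_minimally R) c \<Longrightarrow> c \<noteq> [] \<Longrightarrow> hd c \<noteq> [] \<Longrightarrow> interlaced R c"
    unfolding interlaced_def by (metis append_Nil2 list.collapse)
qed

text \<open>The greedy procedure has cut \<open>h @ x\<close> and cannot go on, because \<open>x\<close> has zero product with the next bar
or because there is no next bar.\<close>

definition stuck :: "'x list set \<Rightarrow> 'x list list \<Rightarrow> 'x list \<Rightarrow> 'x list \<Rightarrow> 'x list list \<Rightarrow> bool" where
  "stuck R qs h x r \<longleftrightarrow> even (length qs) \<and> is_chain R (qs @ [h]) \<and> x \<noteq> [] \<and> normal R (h @ x) \<and>
     bar_term R (qs @ h # x # r) \<and> zero_pairs R ((h @ x) # r) \<and> (r \<noteq> [] \<longrightarrow> \<not> normal R (x @ hd r))"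

text \<open>A cut after which the procedure goes on contributes nothing: the rest \<open>x\<close> and the next bar \<open>c\<close> form a pair with
nonzero product, so the cut bar term has only defective rests.\<close>

lemma transfer_h_onward:
  assumes bt: "bar_term R (ps @ g # x # c # vs)" and ch: "is_chain R (ps @ [g])" and n: "normal R (g @ x)"
    and nc: "normal R (x @ c)" and m: "m \<ge> 1"
  shows "(transfer_h R m (ps @ (g @ x) # c # vs) :: _ \<Rightarrow>\<^sub>0 'k::field) = transfer_h R m (ps @ g # (x @ c) # vs)"
proof -
  have "(transfer R m (ps @ g # x # c # vs) :: _ \<Rightarrow>\<^sub>0 'k) = 0" if "m \<noteq> 1"
  proof (rule transfer_defective[OF bt ch n])
    show "(transfer_h R (m - 1) e :: _ \<Rightarrow>\<^sub>0 'k) = 0" if "bar_term R e" "defective R e" for e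
    proof (rule transfer_h_defective[OF _ that])
      show "m - 1 \<ge> 1" using m \<open>m \<noteq> 1\<close> by linarith
    qed
  qed (use m that nc in auto)
  then show ?thesis using transfer_h_split[OF bt ch n m, where 'k='k] nc by simp
qed

text \<open>The sign is \<open>-1\<close> because the number of bars before the cut is even.\<close>

lemma transfer_h_stuck:
  assumes s: "stuck R qs h x r" and m: "m \<ge> 1"
  shows "(transfer_h R m (qs @ (h @ x) # r) :: _ \<Rightarrow>\<^sub>0 'k::field) =
    (if m = 1 then 0 else scale (-1) (transfer R m (qs @ h # x # r)))"
proof -
  have "onward R qs h x r = {}" using s by (cases r) (auto simp: stuck_def)
  then show ?thesis using s transfer_h_split[of R qs h x r m, where 'k='k] m by (auto simp: stuck_def)
qed

text \<open>The two possible outcomes of the procedure on an interlaced bar term.  For the second one, the cut bar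
term is described from the place behind \<open>ps\<close> on: the greedy bar \<open>g\<close> ends properly before the marker, the marker
splits the following bar, and all rests after an odd number of greedy bars behind \<open>ps\<close> are interlaced again.
The type argument fixes the field, which does not occur otherwise.\<close>

definition reaches_chain where
  "reaches_chain (TYPE('k::field)) R c \<longleftrightarrow> (\<exists>g. is_chain R g \<and> length g = length c \<and> concat g = concat c \<and>
     (\<forall>m\<ge>1. (transfer_h R m c :: _ \<Rightarrow>\<^sub>0 'k) = transfer_h R m g))"

definition reaches_stuck where
  "reaches_stuck (TYPE('k::field)) R ps a b c \<longleftrightarrow>
    (\<exists>qs h x r g a1 b1 rs. stuck R qs h x r \<and> qs @ h # x # r = ps @ g # (a1 @ b1) # rs \<and>
      length ps \<le> length qs \<and> is_chain R (ps @ [g]) \<and> a = g @ a1 \<and> a1 \<noteq> [] \<and> interleaved R a1 b1 rs \<and>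
      (\<forall>i. even i \<and> length ps + i \<le> length qs \<longrightarrow> interlaced R (drop (length ps + i + 1) (qs @ h # x # r))) \<and>
      length (qs @ h # x # r) = length c + 1 \<and> concat (qs @ h # x # r) = concat c \<and>
      (\<forall>m\<ge>1. (transfer_h R m c :: _ \<Rightarrow>\<^sub>0 'k) = transfer_h R m (qs @ (h @ x) # r)))"

lemma reaches_stuckE:
  assumes "reaches_stuck TYPE('k::field) R ps a b c"
  obtains qs h x r g a1 b1 rs where "stuck R qs h x r" "qs @ h # x # r = ps @ g # (a1 @ b1) # rs"
    "length ps \<le> length qs" "is_chain R (ps @ [g])" "a = g @ a1" "a1 \<noteq> []" "interleaved R a1 b1 rs"
    "\<forall>i. even i \<and> length ps + i \<le> length qs \<longrightarrow> interlaced R (drop (length ps + i + 1) (qs @ h # x # r))"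
    "length (qs @ h # x # r) = length c + 1" "concat (qs @ h # x # r) = concat c"
    "\<forall>m\<ge>1. (transfer_h R m c :: _ \<Rightarrow>\<^sub>0 'k) = transfer_h R m (qs @ (h @ x) # r)"
  using assms unfolding reaches_stuck_def by (elim exE conjE) (rule that)

lemma stuck_at_first:
  assumes "stuck R ps g (a1 @ b) r" "a1 \<noteq> []" "interleaved R a1 b r"
  shows "reaches_stuck TYPE('k::field) R ps (g @ a1) b (ps @ (g @ a1 @ b) # r)"
  unfolding reaches_stuck_def
  apply (rule exI[of _ ps], rule exI[of _ g], rule exI[of _ "a1 @ b"], rule exI[of _ r],
      rule exI[of _ g], rule exI[of _ a1], rule exI[of _ b], rule exI[of _ r])
  using assms by (auto simp: stuck_def interlaced_def)

text \<open>The bars in \<open>ps\<close> are greedy, and their even number means that \<open>ps\<close> ends where a bar at an odd place ends.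
The first greedy bar \<open>g\<close> behind \<open>ps\<close> ends at the marker of the current bar or before it, since the word up
to the marker already has zero product with the last bar of \<open>ps\<close>.  So the bar is cut or left as it is,
but the bar term is never upper here.  If \<open>g\<close> ends exactly at a marker, then all later
greedy bars at even places end at markers as well, because both are found by the same rule.  From then on
the procedure cannot stop, as the pieces behind the markers have nonzero product with the next bar.  Hence
in the stuck case every greedy bar at an even place ends properly before its marker, and the old markers
show that the rests are interlaced.\<close>

lemma trajectory:
  assumes "interleaved R a b vs" "even (length ps)" "ps \<noteq> [] \<Longrightarrow> is_chain R ps"
    "ps \<noteq> [] \<Longrightarrow> \<not> normal R (last ps @ a)" "bar_term R (ps @ (a @ b) # vs)"
  shows "reaches_chain TYPE('k::field) R (ps @ (a @ b) # vs) \<or>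
    reaches_stuck TYPE('k) R ps a b (ps @ (a @ b) # vs)"
  using assms
proof (induction arbitrary: ps)
  case (end_even a)
  then obtain g a1 where a: "a = g @ a1" and ch: "is_chain R (ps @ [g])"
    using greedy_bar[of ps R a] by (auto simp: bar_term_append)
  show ?case
  proof (cases "a1 = []")
    case True
    then have "reaches_chain TYPE('k) R (ps @ (a @ []) # [])"
      unfolding reaches_chain_def using ch a by auto
    then show ?thesis ..
  next
    case False
    then have "stuck R ps g (a1 @ []) []"
      using end_even.prems a ch normal_appendD(2)[of R g a1]
      by (auto simp: stuck_def bar_term_append is_chain_iff)
    from stuck_at_first[OF this False interleaved.end_even[OF False], where 'k='k] show ?thesis
      using a by simp
  qed
next
  case (end_odd a b c)
  then obtain g a1 where a: "a = g @ a1" and ch: "is_chain R (ps @ [g])"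
    using greedy_bar[of ps R a] normal_appendD(1)[of R a b] by (auto simp: bar_term_append)
  have gx: "normal R (g @ a1 @ b)" and g: "g \<noteq> []"
    using end_odd.prems(4) a ch by (auto simp: bar_term_append is_chain_iff)
  have z: "zero_minimally R (g @ a1 @ b) c" using end_odd.hyps(2) a by simp
  show ?case
  proof (cases "a1 @ b = []")
    case True
    then have "is_chain R (ps @ [a @ b, c])" using is_chain_snoc ch z a by simp
    then have "reaches_chain TYPE('k) R (ps @ (a @ b) # [c])" unfolding reaches_chain_def by auto
    then show ?thesis ..
  next
    case False
    have bt: "bar_term R (ps @ g # (a1 @ b) # [c])"
      using end_odd.prems(4) a False g normal_appendD[OF gx] by (auto simp: bar_term_append)
    show ?thesis
    proof (cases "normal R ((a1 @ b) @ c)")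
      case True
      then have "zero_minimally R g ((a1 @ b) @ c)" using zero_minimally_shift z g by blast
      then have "is_chain R (ps @ [g, (a1 @ b) @ c])" using is_chain_snoc ch by blast
      moreover have "(transfer_h R m (ps @ (g @ a1 @ b) # c # []) :: _ \<Rightarrow>\<^sub>0 'k) =
          transfer_h R m (ps @ g # ((a1 @ b) @ c) # [])" if "m \<ge> 1" for m
        by (rule transfer_h_onward[OF bt ch gx True that])
      ultimately have "reaches_chain TYPE('k) R (ps @ (a @ b) # [c])"
        unfolding reaches_chain_def by (intro exI[of _ "ps @ [g, (a1 @ b) @ c]"]) (simp add: a)
      then show ?thesis ..
    next
      case ns: False
      then have a1: "a1 \<noteq> []" using end_odd.hyps(3) by auto
      have "stuck R ps g (a1 @ b) [c]"
        using end_odd.prems ch False gx bt z ns by (simp add: stuck_def)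
      moreover have "interleaved R a1 b [c]"
        using a1 zero_minimally_suffix[OF z False ns] end_odd.hyps(3) by (intro interleaved.end_odd)
      ultimately show ?thesis using stuck_at_first[of R ps g a1 b "[c]", where 'k='k] a1 a by simp
    qed
  qed
next
  case (step a b c a' b' vs)
  then obtain g a1 where a: "a = g @ a1" and ch: "is_chain R (ps @ [g])"
    using greedy_bar[of ps R a] normal_appendD(1)[of R a b] by (auto simp: bar_term_append)
  have gx: "normal R (g @ a1 @ b)" and g: "g \<noteq> []"
    using step.prems(4) a ch by (auto simp: bar_term_append is_chain_iff)
  have z: "zero_minimally R (g @ a1 @ b) c" using step.hyps(2) a by simp
  show ?case
  proof (cases "a1 @ b \<noteq> [] \<and> \<not> normal R ((a1 @ b) @ c)")
    case True
    have bt: "bar_term R (ps @ g # (a1 @ b) # c # (a' @ b') # vs)"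
      using step.prems(4) a True g normal_appendD[OF gx] by (auto simp: bar_term_append)
    have a1: "a1 \<noteq> []" using True zero_minimallyD(3)[OF step.hyps(3)] by auto
    have "stuck R ps g (a1 @ b) (c # (a' @ b') # vs)"
      using step.prems ch True gx bt z interleaved_zero_pairs[OF step.hyps(4)] by (simp add: stuck_def)
    moreover have "interleaved R a1 b (c # (a' @ b') # vs)"
      using a1 zero_minimally_suffix[OF z] True step.hyps by (intro interleaved.step) auto
    ultimately show ?thesis
      using stuck_at_first[of R ps g a1 b "c # (a' @ b') # vs", where 'k='k] a1 a by simp
  next
    case False
    \<comment> \<open>The two greedy bars that replace the current pair; without a cut, they are that pair itself.\<close>
    define c' where "c' = (a1 @ b) @ c"
    define ps' where "ps' = ps @ [g, c']"
    have zc: "zero_minimally R g c'"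
      using False z zero_minimally_shift[OF z g] by (auto simp: c'_def)
    have ch': "is_chain R ps'" using is_chain_snoc ch zc by (simp add: ps'_def)
    have bt': "bar_term R (ps' @ (a' @ b') # vs)"
      using step.prems(4) zero_minimallyD[OF zc] g ch
      by (auto simp: bar_term_append ps'_def is_chain_iff)
    have "\<not> normal R (last ps' @ a')"
      using zero_minimallyD(5)[OF step.hyps(3)] normal_appendD(2)[of R a1 "b @ c @ a'"]
      by (auto simp: ps'_def c'_def)
    then have IH: "reaches_chain TYPE('k) R (ps' @ (a' @ b') # vs) \<or>
        reaches_stuck TYPE('k) R ps' a' b' (ps' @ (a' @ b') # vs)"
      using step.prems(1) ch' bt' by (intro step.IH) (auto simp: ps'_def)
    have eq: "(transfer_h R m (ps @ (a @ b) # c # (a' @ b') # vs) :: _ \<Rightarrow>\<^sub>0 'k) =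
        transfer_h R m (ps' @ (a' @ b') # vs)" if m: "m \<ge> 1" for m
    proof (cases "a1 @ b = []")
      case True
      then show ?thesis by (simp add: ps'_def c'_def a)
    next
      case ne: False
      have bt: "bar_term R (ps @ g # (a1 @ b) # c # (a' @ b') # vs)"
        using step.prems(4) a ne g normal_appendD[OF gx] by (auto simp: bar_term_append)
      show ?thesis using transfer_h_onward[OF bt ch gx _ m, where 'k='k] ne False by (simp add: a ps'_def c'_def)
    qed
    have len: "length (ps' @ (a' @ b') # vs) = length (ps @ (a @ b) # c # (a' @ b') # vs)"
      and con: "concat (ps' @ (a' @ b') # vs) = concat (ps @ (a @ b) # c # (a' @ b') # vs)"
      by (simp_all add: ps'_def c'_def a)
    from IH show ?thesis
    proof
      assume "reaches_chain TYPE('k) R (ps' @ (a' @ b') # vs)"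
      then have "reaches_chain TYPE('k) R (ps @ (a @ b) # c # (a' @ b') # vs)"
        unfolding reaches_chain_def len con using eq by metis
      then show ?thesis ..
    next
      assume "reaches_stuck TYPE('k) R ps' a' b' (ps' @ (a' @ b') # vs)"
      then obtain qs h x r g' a1' b1' rs where st: "stuck R qs h x r"
        and d: "qs @ h # x # r = ps' @ g' # (a1' @ b1') # rs"
        and lq: "length ps' \<le> length qs" and chg: "is_chain R (ps' @ [g'])"
        and a': "a' = g' @ a1'" "a1' \<noteq> []" and il: "interleaved R a1' b1' rs"
        and gd: "\<forall>i. even i \<and> length ps' + i \<le> length qs \<longrightarrow> interlaced R (drop (length ps' + i + 1) (qs @ h # x # r))"
        and ld: "length (qs @ h # x # r) = length (ps' @ (a' @ b') # vs) + 1"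
        and cd: "concat (qs @ h # x # r) = concat (ps' @ (a' @ b') # vs)"
        and th: "\<forall>m\<ge>1. (transfer_h R m (ps' @ (a' @ b') # vs) :: _ \<Rightarrow>\<^sub>0 'k) = transfer_h R m (qs @ (h @ x) # r)"
        by (rule reaches_stuckE)
      \<comment> \<open>The next greedy bar at an even place ends before its marker, so the present one does too.\<close>
      have zg: "zero_minimally R c' g'"
        using is_chain_successive[of R "ps @ [g]" c' g' "[]"] chg by (simp add: ps'_def)
      have ng: "normal R ((b @ c) @ g')"
        using zero_minimallyD(6)[OF step.hyps(3), of g'] a' by (simp add: strict_prefix_def)
      then have a1: "a1 \<noteq> []" using zero_minimallyD(5)[OF zg] by (auto simp: c'_def)
      have "zero_minimally R (b @ c @ g') a1'"
        unfolding zero_minimally_def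
      proof (intro conjI allI impI)
        show "b @ c @ g' \<noteq> []" using zero_minimallyD(2)[OF zg] by simp
        show "normal R a1'" using zero_minimallyD(4)[OF step.hyps(3)] a' normal_appendD(2) by blast
        show "\<not> normal R ((b @ c @ g') @ a1')" using zero_minimallyD(5)[OF step.hyps(3)] a' by simp
        fix p assume "strict_prefix p a1'"
        then have "strict_prefix (g' @ p) a'" using a' by (simp add: strict_prefix_def)
        then show "normal R ((b @ c @ g') @ p)" using zero_minimallyD(6)[OF step.hyps(3)] by simp
      qed (use ng a' in simp_all)
      then have il': "interleaved R a1 (b @ c) (g' # (a1' @ b1') # rs)"
        using a1 zg il by (intro interleaved.step) (auto simp: c'_def)
      have d': "qs @ h # x # r = ps @ g # (a1 @ b @ c) # g' # (a1' @ b1') # rs"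
        using d by (simp add: ps'_def c'_def)
      have gd': "interlaced R (drop (length ps + i + 1) (qs @ h # x # r))" if "even i" "length ps + i \<le> length qs" for i
      proof (cases "i = 0")
        case True
        then show ?thesis unfolding d' interlaced_def using il' by auto
      next
        case False
        then have "2 \<le> i" using that(1) by presburger
        then obtain k where k: "i = 2 + k" by (rule less_eqE)
        then have "even k" using that(1) by simp
        then show ?thesis using gd[rule_format, of k] that k by (simp add: ps'_def)
      qed
      have "reaches_stuck TYPE('k) R ps a b (ps @ (a @ b) # c # (a' @ b') # vs)"
        unfolding reaches_stuck_def
      proof (intro exI conjI allI impI)
        show "stuck R qs h x r" by (rule st)
        show "qs @ h # x # r = ps @ g # (a1 @ b @ c) # g' # (a1' @ b1') # rs" by (rule d')
        show "length ps \<le> length qs" using lq by (simp add: ps'_def)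
        show "is_chain R (ps @ [g])" "a = g @ a1" "a1 \<noteq> []" by (rule ch a a1)+
        show "interleaved R a1 (b @ c) (g' # (a1' @ b1') # rs)" by (rule il')
        show "length (qs @ h # x # r) = length (ps @ (a @ b) # c # (a' @ b') # vs) + 1"
          using ld len by (simp only:)
        show "concat (qs @ h # x # r) = concat (ps @ (a @ b) # c # (a' @ b') # vs)"
          using cd con by (simp only:)
        show "(transfer_h R m (ps @ (a @ b) # c # (a' @ b') # vs) :: _ \<Rightarrow>\<^sub>0 'k) =
            transfer_h R m (qs @ (h @ x) # r)" if "1 \<le> m" for m
          using th that eq[OF that] by (simp only:)
      qed (use gd' in blast)
      then show ?thesis ..
    qed
  qed
qed

section \<open>Counting bars\<close>

lemma is_chain_comparable:
  assumes "is_chain R g" "is_chain R g'" "concat g @ s = concat g' @ s'"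
  shows "prefix g g' \<or> prefix g' g"
proof (rule ccontr)
  assume "\<not> ?thesis"
  then have "g \<parallel> g'" by (auto simp: parallel_def)
  then obtain qs x r x' r' where g: "g = qs @ x # r" and g': "g' = qs @ x' # r'" and ne: "x \<noteq> x'"
    using parallel_decomp by blast
  have ch: "is_chain R (qs @ [x])" "is_chain R (qs @ [x'])"
    using assms(1,2) is_chain_prefix[of R "qs @ [x]" r] is_chain_prefix[of R "qs @ [x']" r'] by (auto simp: g g')
  have "x @ (concat r @ s) = x' @ (concat r' @ s')" using assms(3) by (simp add: g g')
  then obtain t where "x = x' @ t \<or> x' = x @ t" by (auto simp: append_eq_append_conv2)
  then show False using is_chain_last_unique ch ne by (metis append_Nil2)
qed

text \<open>Two neighbouring bars of one list in \<open>\<Gamma>\<close> contain a relation, whereas the word of the first pair of \<open>l\<close> without its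
last letter contains none.  So each pair of \<open>l\<close> accounts for at most two bars, apart from one
additional bar for each list in \<open>\<Gamma>\<close>.  When the last bar is reached, its word still lies in a remaining entry of
\<open>l\<close>, which saves one.\<close>

lemma bar_count_bound:
  assumes "\<Gamma> \<noteq> []" "\<And>\<gamma>. \<gamma> \<in> set \<Gamma> \<Longrightarrow> \<gamma> \<noteq> [] \<and> [] \<notin> set \<gamma> \<and> successively (\<lambda>u v. \<not> normal R (u @ v)) \<gamma>"
    and "suffix (concat (map concat \<Gamma>)) (concat l)" "zero_pairs R l" "\<And>v. v \<in> set l \<Longrightarrow> normal R v"
  shows "sum_list (map length \<Gamma>) + 1 \<le> length l + length \<Gamma>"
  using assms
proof (induction "sum_list (map length \<Gamma>)" arbitrary: \<Gamma> l rule: less_induct)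
  case less
  obtain \<gamma> \<Gamma>' where \<Gamma>: "\<Gamma> = \<gamma> # \<Gamma>'" using less.prems(1) by (cases \<Gamma>) auto
  obtain u us where \<gamma>: "\<gamma> = u # us" using less.prems(2)[of \<gamma>] \<Gamma> by (cases \<gamma>) auto
  have u: "u \<noteq> []" using less.prems(2)[of \<gamma>] \<Gamma> \<gamma> by auto
  have l: "l \<noteq> []" using less.prems(3) \<Gamma> \<gamma> u by auto
  show ?case
  proof (cases us)
    case Nil
    show ?thesis
    proof (cases "\<Gamma>' = []")
      case True
      then show ?thesis using l \<Gamma> \<gamma> Nil by (cases l) auto
    next
      case False
      have "suffix (concat (map concat \<Gamma>')) (concat l)"
        using less.prems(3) suffix_appendD[of u] by (auto simp: \<Gamma> \<gamma> Nil)
      then have "sum_list (map length \<Gamma>') + 1 \<le> length l + length \<Gamma>'"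
        using less.prems False by (intro less.hyps) (auto simp: \<Gamma> \<gamma> Nil)
      then show ?thesis by (simp add: \<Gamma> \<gamma> Nil)
    qed
  next
    case (Cons u' us')
    have uu: "\<not> normal R (u @ u')" using less.prems(2)[of \<gamma>] by (simp add: \<Gamma> \<gamma> Cons)
    define t where "t = concat us' @ concat (map concat \<Gamma>')"
    have w: "concat (map concat \<Gamma>) = (u @ u') @ t" by (simp add: \<Gamma> \<gamma> Cons t_def)
    obtain f where f: "concat l = f @ (u @ u') @ t" using less.prems(3) unfolding w suffix_def by blast
    obtain y l1 where l1: "l = y # l1" using l by (cases l) auto
    have "l1 \<noteq> []"
    proof
      assume "l1 = []"
      then have "normal R (f @ (u @ u') @ t)" using less.prems(5)[of y] f l1 by simp
      then show False using uu normal_appendD by blast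
    qed
    then obtain y' l' where ll: "l = y # y' # l'" using l1 by (cases l1) auto
    have z: "zero_minimally R y y'" "zero_pairs R l'" using less.prems(4) ll by auto
    have "suffix t (concat l')"
    proof (rule ccontr)
      assume ns: "\<not> suffix t (concat l')"
      have "(f @ u @ u') @ t = (y @ y') @ concat l'" using f ll by simp
      from append_eq_append_conv2[THEN iffD1, OF this]
      obtain e where "f @ u @ u' = (y @ y') @ e \<and> e @ t = concat l' \<or>
          (f @ u @ u') @ e = y @ y' \<and> t = e @ concat l'" by blast
      moreover have "e @ t \<noteq> concat l'" using ns by (metis suffixI)
      ultimately have "(f @ u @ u') @ e = y @ y'" and et: "t = e @ concat l'" by blast+
      then have e: "y @ y' = f @ (u @ u') @ e" by simp
      have "e \<noteq> []" using ns et by auto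
      have "normal R (f @ u @ u')"
      proof (cases "prefix (f @ u @ u') y")
        case True
        then show ?thesis using zero_minimallyD(3)[OF z(1)] normal_appendD(1) unfolding prefix_def by blast
      next
        case False
        moreover have "prefix (f @ u @ u') (y @ y')" using e by (auto simp: prefix_def)
        ultimately obtain q where q: "f @ u @ u' = y @ q" by (auto simp: prefix_append)
        then have "y' = q @ e" using e by (metis append_assoc same_append_eq)
        then have "strict_prefix q y'" using \<open>e \<noteq> []\<close> by (simp add: strict_prefix_def)
        then show ?thesis using zero_minimallyD(6)[OF z(1)] q by simp
      qed
      then show False using uu normal_appendD by blast
    qed
    show ?thesis
    proof (cases "us' = []")
      case True
      show ?thesis
      proof (cases "\<Gamma>' = []")
        case True
        then show ?thesis by (simp add: \<Gamma> \<gamma> Cons \<open>us' = []\<close> ll)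
      next
        case False
        have "sum_list (map length \<Gamma>') + 1 \<le> length l' + length \<Gamma>'"
          using less.prems(2,5) False \<open>suffix t (concat l')\<close> z(2) True
          by (intro less.hyps) (auto simp: \<Gamma> \<gamma> Cons t_def ll)
        then show ?thesis by (simp add: \<Gamma> \<gamma> Cons True ll)
      qed
    next
      case False
      have "sum_list (map length (us' # \<Gamma>')) + 1 \<le> length l' + length (us' # \<Gamma>')"
      proof (rule less.hyps)
        show "\<gamma>' \<noteq> [] \<and> [] \<notin> set \<gamma>' \<and> successively (\<lambda>u v. \<not> normal R (u @ v)) \<gamma>'"
          if "\<gamma>' \<in> set (us' # \<Gamma>')" for \<gamma>'
          using that less.prems(2)[of \<gamma>] less.prems(2)[of \<gamma>'] False
          by (auto simp: \<Gamma> \<gamma> Cons successively_Cons)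
      qed (use \<open>suffix t (concat l')\<close> z(2) less.prems(5) in \<open>auto simp: \<Gamma> \<gamma> Cons t_def ll\<close>)
      then show ?thesis by (simp add: \<Gamma> \<gamma> Cons ll)
    qed
  qed
qed

lemma chains_count_bound:
  assumes "\<Gamma> \<noteq> []" "\<And>\<gamma>. \<gamma> \<in> set \<Gamma> \<Longrightarrow> is_chain R \<gamma>" "concat (map concat \<Gamma>) = concat l"
    "zero_pairs R l" "\<And>v. v \<in> set l \<Longrightarrow> normal R v"
  shows "sum_list (map length \<Gamma>) + 1 \<le> length l + length \<Gamma>"
proof (rule bar_count_bound[OF assms(1)])
  fix \<gamma> assume "\<gamma> \<in> set \<Gamma>"
  then have g: "bar_term R \<gamma>" "successively (zero_minimally R) \<gamma>"
    using assms(2) by (auto simp: is_chain_iff)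
  from g(2) have "successively (\<lambda>u v. \<not> normal R (u @ v)) \<gamma>"
    by (rule successively_mono) (auto simp: zero_minimally_def)
  then show "\<gamma> \<noteq> [] \<and> [] \<notin> set \<gamma> \<and> successively (\<lambda>u v. \<not> normal R (u @ v)) \<gamma>"
    using g(1) by (auto simp: bar_term_def)
qed (use assms in auto)

lemma successively_zero_pairs: "successively (zero_minimally R) l \<Longrightarrow> zero_pairs R l"
proof (induction l rule: induct_list012)
  case (3 x y zs)
  then show ?case by (cases zs) auto
qed auto

lemma zero_pairs_append:
  "successively (zero_minimally R) us \<Longrightarrow> even (length us) \<Longrightarrow> zero_pairs R vs \<Longrightarrow> zero_pairs R (us @ vs)"
proof (induction us rule: induct_list012)
  case (3 x y zs)
  then show ?case by (cases zs) auto
qed auto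

section \<open>The coefficients on tails\<close>

text \<open>The tuples that should occur in \<open>p\<^bsup>\<otimes>m\<^esup> \<Delta>'\<^sub>m h c\<close>: the degree of this map is \<open>m - 1\<close>, so that the number of
bars grows by \<open>m - 1\<close>.\<close>

definition chain_tuple :: "'x list set \<Rightarrow> nat \<Rightarrow> 'x list list \<Rightarrow> 'x list list list \<Rightarrow> bool" where
  "chain_tuple R m c \<Gamma> \<longleftrightarrow> length \<Gamma> = m \<and> (\<forall>\<gamma>\<in>set \<Gamma>. is_chain R \<gamma>) \<and> concat (map concat \<Gamma>) = concat c \<and>
     sum_list (map length \<Gamma>) + 1 = length c + m"

lemma chain_tuple_Cons:
  assumes "is_chain R (take i d)" "concat d = concat c" "length d = length c + 1" "i \<le> length d" "m \<ge> 2"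
  shows "chain_tuple R m c (take i d # \<Gamma>) \<longleftrightarrow> chain_tuple R (m - 1) (drop i d) \<Gamma>"
proof -
  have "concat c = concat (take i d) @ concat (drop i d)"
    unfolding assms(2)[symmetric] by (metis append_take_drop_id concat_append)
  then show ?thesis using assms(1,3-5) by (auto simp: chain_tuple_def)
qed

lemma concat_nonempty: "bar_term R c \<Longrightarrow> concat c \<noteq> []"
  by (cases c) (auto simp: bar_term_def)

lemma chain_tuple_1:
  assumes "is_chain R g" "concat g = concat c" "length g = length c"
  shows "chain_tuple R 1 c \<Gamma> \<longleftrightarrow> \<Gamma> = [g]"
proof
  assume "chain_tuple R 1 c \<Gamma>"
  then obtain \<gamma> where \<gamma>: "\<Gamma> = [\<gamma>]" "is_chain R \<gamma>" "concat \<gamma> = concat c" "length \<gamma> = length c"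
    by (auto simp: chain_tuple_def length_Suc_conv)
  then have "prefix g \<gamma> \<or> prefix \<gamma> g" using is_chain_comparable[of R g \<gamma> "[]" "[]"] assms by simp
  then have "g = \<gamma>" using assms(3) \<gamma>(4) by (auto simp: prefix_def)
  then show "\<Gamma> = [g]" using \<gamma> by simp
qed (use assms in \<open>auto simp: chain_tuple_def\<close>)

text \<open>If a chain \<open>g\<close> with the same word has only as many bars as \<open>c\<close>, then the rest of \<open>g\<close> behind the first chain of the
tuple consists of vanishing pairs, too few for the remaining bars.\<close>

lemma no_chain_tuple:
  assumes g: "is_chain R g" "concat g = concat c" "length g = length c" and m: "m \<ge> 2"
  shows "\<not> chain_tuple R m c \<Gamma>"
proof
  assume t: "chain_tuple R m c \<Gamma>"
  then obtain \<gamma> \<Gamma>' where \<Gamma>: "\<Gamma> = \<gamma> # \<Gamma>'" using m by (cases \<Gamma>) (auto simp: chain_tuple_def)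
  have ne: "\<Gamma>' \<noteq> []" using t m \<Gamma> by (auto simp: chain_tuple_def)
  have c\<gamma>: "is_chain R \<gamma>" "concat \<gamma> @ concat (map concat \<Gamma>') = concat g"
    using t \<Gamma> g(2) by (auto simp: chain_tuple_def)
  obtain \<delta> \<Delta> where \<delta>: "\<Gamma>' = \<delta> # \<Delta>" using ne by (cases \<Gamma>') auto
  then have "is_chain R \<delta>" using t \<Gamma> by (simp add: chain_tuple_def)
  then have w: "concat (map concat \<Gamma>') \<noteq> []"
    using concat_nonempty[OF is_chainD(1)] unfolding \<delta> by fastforce
  have "prefix \<gamma> g"
    using is_chain_comparable[OF c\<gamma>(1) g(1), of "concat (map concat \<Gamma>')" "[]"] c\<gamma>(2) w
    by (auto simp: prefix_def)
  then obtain l where l: "g = \<gamma> @ l" by (auto simp: prefix_def)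
  have "sum_list (map length \<Gamma>') + 1 \<le> length l + length \<Gamma>'"
  proof (rule chains_count_bound[OF ne])
    show "is_chain R \<gamma>'" if "\<gamma>' \<in> set \<Gamma>'" for \<gamma>' using that t by (auto simp: \<Gamma> chain_tuple_def)
    show "concat (map concat \<Gamma>') = concat l" using c\<gamma>(2) by (simp add: l)
    show "zero_pairs R l" using is_chainD(3)[OF g(1)]
      by (auto simp: l successively_append_iff intro: successively_zero_pairs)
    show "normal R v" if "v \<in> set l" for v using is_chainD(1)[OF g(1)] that by (auto simp: l bar_term_def)
  qed
  then show False using t g(3) by (auto simp: chain_tuple_def \<Gamma> l)
qed

text \<open>A chain that continues behind \<open>h\<close> would need a bar that is longer than \<open>x\<close>, as \<open>h @ x\<close> is normal.  This bar
cannot end inside the bar behind \<open>x\<close>, because \<open>h @ x\<close> and that bar vanish minimally, and it cannot contain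
that bar, because its product with \<open>x\<close> vanishes.\<close>

lemma stuck_chain_prefix:
  assumes s: "stuck R qs h x r" and \<gamma>: "is_chain R \<gamma>" "concat \<gamma> @ s' = concat (qs @ h # x # r)"
  shows "prefix \<gamma> (qs @ [h])"
proof (rule ccontr)
  assume np: "\<not> prefix \<gamma> (qs @ [h])"
  have "is_chain R (qs @ [h])" using s by (simp add: stuck_def)
  from is_chain_comparable[OF \<gamma>(1) this, of s' "concat (x # r)"] np
  obtain ys where ys: "\<gamma> = qs @ [h] @ ys" using \<gamma>(2) by (auto simp: prefix_def)
  then obtain y zs where y: "\<gamma> = qs @ h # y # zs" using np by (cases ys) auto
  have z: "zero_minimally R h y" using is_chain_successive \<gamma>(1) y by metis
  have eq: "y @ (concat zs @ s') = x @ concat r" using \<gamma>(2) y by simp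
  have nxy: "\<not> prefix y x"
    using s zero_minimallyD(5)[OF z] normal_appendD(1)[of R "h @ y"] by (auto simp: stuck_def prefix_def)
  then obtain t where t: "y = x @ t" "t \<noteq> []" "t @ (concat zs @ s') = concat r"
    using eq by (auto simp: append_eq_append_conv2 prefix_def)
  then obtain c r' where r: "r = c # r'" by (cases r) auto
  have zc: "zero_minimally R (h @ x) c" and xc: "\<not> normal R (x @ c)" using s by (auto simp: stuck_def r)
  have "prefix t (concat r)" using t(3) by (metis prefixI)
  moreover have "prefix c (concat r)" by (simp add: r)
  ultimately consider "strict_prefix t c" | q where "t = c @ q"
    using prefix_same_cases by (metis prefix_def strict_prefix_def)
  then show False
  proof cases
    case 1
    then show False using zero_minimallyD(6)[OF zc] zero_minimallyD(5)[OF z] t(1) by simp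
  next
    case 2
    then show False using xc zero_minimallyD(4)[OF z] t(1) normal_appendD(1)[of R "x @ c" q] by simp
  qed
qed

text \<open>Only splittings after an odd number of bars are possible: after an even number, merging \<open>h\<close> and \<open>x\<close> turns the rest
into a sequence of vanishing pairs with one bar less, and the bound on the number of bars is violated.\<close>

lemma stuck_first_chain:
  assumes s: "stuck R qs h x r" and d: "d = qs @ h # x # r"
    and c: "concat d = concat c" "length d = length c + 1"
    and t: "chain_tuple R m c \<Gamma>" and m: "m \<ge> 1"
  obtains i \<Gamma>' where "m \<ge> 2" "odd i" "1 \<le> i" "i \<le> length qs + 1" "\<Gamma> = take i d # \<Gamma>'" "is_chain R (take i d)"
proof -
  obtain \<gamma> \<Gamma>' where \<Gamma>: "\<Gamma> = \<gamma> # \<Gamma>'" using t m by (cases \<Gamma>) (auto simp: chain_tuple_def)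
  have c\<gamma>: "is_chain R \<gamma>" "concat \<gamma> @ concat (map concat \<Gamma>') = concat (qs @ h # x # r)"
    using t \<Gamma> c d by (auto simp: chain_tuple_def)
  have "prefix \<gamma> (qs @ [h])" by (rule stuck_chain_prefix[OF s c\<gamma>])
  define i where "i = length \<gamma>"
  have i: "1 \<le> i" "i \<le> length qs + 1"
    using is_chainD(4)[OF c\<gamma>(1)] prefix_length_le[OF \<open>prefix \<gamma> (qs @ [h])\<close>] by (auto simp: i_def Suc_le_eq)
  have ti: "\<gamma> = take i d" using \<open>prefix \<gamma> (qs @ [h])\<close> by (auto simp: i_def d prefix_def append_eq_append_conv2 Cons_eq_append_conv)
  have cd: "concat (map concat \<Gamma>') = concat (drop i d)"
    using c\<gamma>(2) unfolding d[symmetric] ti by (metis append_take_drop_id concat_append same_append_eq)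
  have "drop i d = drop i (qs @ [h]) @ x # r" using i(2) by (cases "i = length qs + 1") (auto simp: d)
  then have "x \<in> set (drop i d)" by simp
  then have "concat (drop i d) \<noteq> []" using s by (auto simp: stuck_def)
  then have ne: "\<Gamma>' \<noteq> []" using cd by auto
  then have m2: "m \<ge> 2" using t \<Gamma> by (cases \<Gamma>') (auto simp: chain_tuple_def)
  have "odd i"
  proof (rule ccontr)
    assume "\<not> odd i"
    then have ev: "even i" by simp
    moreover have "even (length qs)" using s by (simp add: stuck_def)
    ultimately have iq: "i \<le> length qs" using i(2) by (cases "i = length qs + 1") auto
    \<comment> \<open>Undoing the last cut restores a sequence of vanishing pairs.\<close>
    define l where "l = drop i qs @ (h @ x) # r"
    have "sum_list (map length \<Gamma>') + 1 \<le> length l + length \<Gamma>'"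
    proof (rule chains_count_bound[OF ne])
      show "is_chain R \<gamma>'" if "\<gamma>' \<in> set \<Gamma>'" for \<gamma>' using that t by (auto simp: \<Gamma> chain_tuple_def)
      show "concat (map concat \<Gamma>') = concat l" using cd iq by (simp add: l_def d)
      have "successively (zero_minimally R) qs"
        using s is_chainD(3)[of R "qs @ [h]"] by (simp add: stuck_def successively_append_iff)
      then show "zero_pairs R l" unfolding l_def using s ev iq
        by (intro zero_pairs_append successively_drop) (auto simp: stuck_def)
      show "normal R v" if "v \<in> set l" for v
        using that s by (auto simp: l_def stuck_def bar_term_append dest: in_set_dropD)
    qed
    moreover have "length l + 1 = length d - i" using iq by (simp add: l_def d)
    moreover have "i + sum_list (map length \<Gamma>') + 1 = length c + m" "length \<Gamma>' + 1 = m"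
      using t by (auto simp: chain_tuple_def \<Gamma> i_def)
    ultimately show False using c(2) i(2) by (simp add: d)
  qed
  then show ?thesis using that m2 i \<Gamma> ti c\<gamma>(1) by blast
qed

text \<open>A tuple determines the place of the first splitting by the length of its first chain, so the sum over
the splittings has at most one nonzero term.  Each of the \<open>m - 1\<close> applications of \<open>h\<close> that precede a splitting
contributes the factor \<open>-1\<close>, and the remaining signs are trivial as the first chain of each splitting has
an odd number of bars.\<close>

lemma lookup_transfer_h_interlaced:
  fixes R :: "'x list set"
  assumes "m \<ge> 1" "interlaced R c" "bar_term R c"
  shows "Poly_Mapping.lookup (transfer_h R m c :: _ \<Rightarrow>\<^sub>0 'k::field) \<Gamma> = (if chain_tuple R m c \<Gamma> then (-1) ^ (m - 1) else 0)
    \<and> (chain_tuple R m c \<Gamma> \<longrightarrow> (\<forall>\<gamma>\<in>set (butlast \<Gamma>). odd (length \<gamma>)))"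
  using assms
proof (induction m arbitrary: c \<Gamma>)
  case 0
  then show ?case by simp
next
  case (Suc m)
  obtain a b vs where c: "c = (a @ b) # vs" and il: "interleaved R a b vs"
    using Suc.prems(2) by (auto simp: interlaced_def)
  have "reaches_chain TYPE('k) R c \<or> reaches_stuck TYPE('k) R [] a b c"
    using trajectory[OF il, of "[]", where 'k='k] Suc.prems(3) by (simp add: c)
  then show ?case
  proof
    assume "reaches_chain TYPE('k) R c"
    then obtain g where g: "is_chain R g" "concat g = concat c" "length g = length c"
      and "\<forall>m\<ge>1. (transfer_h R m c :: _ \<Rightarrow>\<^sub>0 'k) = transfer_h R m g"
      unfolding reaches_chain_def by blast
    then have th: "(transfer_h R (Suc m) c :: _ \<Rightarrow>\<^sub>0 'k) = transfer_h R (Suc m) g" by simp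
    show ?thesis
    proof (cases "m = 0")
      case True
      then have "chain_tuple R (Suc m) c \<Gamma> \<longleftrightarrow> \<Gamma> = [g]" using chain_tuple_1[OF g] by (metis One_nat_def)
      moreover have "(transfer_h R (Suc m) c :: _ \<Rightarrow>\<^sub>0 'k) = Poly_Mapping.single [g] 1"
        unfolding th using transfer_h_chain[OF g(1), of "Suc m", where 'k='k] True by simp
      ultimately show ?thesis using True by (auto simp: lookup_single when_def)
    next
      case False
      then have "\<not> chain_tuple R (Suc m) c \<Gamma>" by (intro no_chain_tuple[OF g]) simp
      moreover have "(transfer_h R (Suc m) c :: _ \<Rightarrow>\<^sub>0 'k) = 0"
        unfolding th using transfer_h_chain[OF g(1), of "Suc m", where 'k='k] False by simp
      ultimately show ?thesis by simp
    qed
  next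
    assume "reaches_stuck TYPE('k) R [] a b c"
    then obtain qs h x r where st: "stuck R qs h x r"
      and gd: "\<forall>i. even i \<and> length ([] :: 'x list list) + i \<le> length qs \<longrightarrow>
        interlaced R (drop (length ([] :: 'x list list) + i + 1) (qs @ h # x # r))"
      and lc: "length (qs @ h # x # r) = length c + 1" and cc: "concat (qs @ h # x # r) = concat c"
      and th: "\<forall>m\<ge>1. (transfer_h R m c :: _ \<Rightarrow>\<^sub>0 'k) = transfer_h R m (qs @ (h @ x) # r)"
      by (rule reaches_stuckE) (rule that)
    define d where "d = qs @ h # x # r"
    have bt: "bar_term R (qs @ h # x # r)" and ch: "is_chain R (qs @ [h])" and n: "normal R (h @ x)"
      using st by (auto simp: stuck_def)
    have lcd: "length d = length c + 1" "concat d = concat c" using lc cc by (auto simp: d_def)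
    have ld: "length qs + 2 \<le> length d" by (simp add: d_def)
    have gd': "interlaced R (drop i d)" if "odd i" "i \<le> length qs + 1" for i
      using gd[rule_format, of "i - 1"] that unfolding d_def[symmetric] by (cases i) auto
    show ?thesis
    proof (cases "m = 0")
      case True
      have "\<not> chain_tuple R (Suc m) c \<Gamma>"
        using stuck_first_chain[OF st d_def lcd(2,1), of "Suc m" \<Gamma>] True by auto
      then show ?thesis using th transfer_h_stuck[OF st, of "Suc m", where 'k='k] True by simp
    next
      case False
      have ch_i: "is_chain R (take i d)" if "1 \<le> i" "i \<le> length qs + 1" for i
      proof -
        have "take i d = take i (qs @ [h])" using that by (cases "i = length qs + 1") (auto simp: d_def)
        moreover have "qs @ [h] = take i (qs @ [h]) @ drop i (qs @ [h])" "take i (qs @ [h]) \<noteq> []"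
          using that by (simp_all only: append_take_drop_id) simp
        ultimately show ?thesis using ch is_chain_prefix by metis
      qed
      have IH: "Poly_Mapping.lookup (transfer_h R m (drop i d) :: _ \<Rightarrow>\<^sub>0 'k) \<Gamma>' =
          (if chain_tuple R m (drop i d) \<Gamma>' then (-1) ^ (m - 1) else 0)"
        "chain_tuple R m (drop i d) \<Gamma>' \<Longrightarrow> \<forall>\<gamma>\<in>set (butlast \<Gamma>'). odd (length \<gamma>)"
        if "odd i" "i \<le> length qs + 1" for i \<Gamma>'
        using Suc.IH[of "drop i d" \<Gamma>'] gd'[OF that] bar_term_drop[of R d i] bt that(2) ld False
        by (auto simp: d_def)
      \<comment> \<open>After an even number of greedy bars the cut falls inside a pair of the rest.\<close>
      have even_0: "(transfer_h R m (drop i d) :: _ \<Rightarrow>\<^sub>0 'k) = 0" if "even i" "i \<le> length qs + 1" for i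
      proof (rule transfer_h_defective)
        show "bar_term R (drop i d)" using bar_term_drop[of R d i] bt that ld by (simp add: d_def)
        have "odd (length qs + 1 - i)" using that st by (auto simp: stuck_def)
        then show "defective R (drop i d)" unfolding d_def using that by (intro defective_drop[OF ch n]) auto
      qed (use False in simp)
      have tc: "chain_tuple R (Suc m) c (take i d # \<Gamma>') \<longleftrightarrow> chain_tuple R m (drop i d) \<Gamma>'"
        if "1 \<le> i" "i \<le> length qs + 1" for i \<Gamma>'
        using chain_tuple_Cons[OF ch_i[OF that] lcd(2,1), of "Suc m" \<Gamma>'] that ld False by simp
      let ?t = "\<lambda>i. if \<Gamma> \<noteq> [] \<and> hd \<Gamma> = take i d then
          (-1) ^ (Suc m * (i + 1)) * Poly_Mapping.lookup (transfer_h R m (drop i d) :: _ \<Rightarrow>\<^sub>0 'k) (tl \<Gamma>) else 0"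
      have "(transfer_h R (Suc m) c :: _ \<Rightarrow>\<^sub>0 'k) = scale (-1) (transfer R (Suc m) d)"
        using th transfer_h_stuck[OF st, of "Suc m", where 'k='k] False by (simp add: d_def)
      moreover have "Poly_Mapping.lookup (transfer R (Suc m) d :: _ \<Rightarrow>\<^sub>0 'k) \<Gamma> = (\<Sum>i\<in>{1..length qs + 1}. ?t i)"
      proof -
        have "Suc m \<ge> 2" using False by simp
        from transfer_split[OF bt ch n this, where 'k='k]
        show ?thesis unfolding d_def[symmetric] diff_Suc_1
          by (simp only: lookup_sum lookup_scale lookup_tens_single if_distrib[of "(*) _"] mult_zero_right)
      qed
      ultimately have lk: "Poly_Mapping.lookup (transfer_h R (Suc m) c :: _ \<Rightarrow>\<^sub>0 'k) \<Gamma> = - (\<Sum>i\<in>{1..length qs + 1}. ?t i)"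
        by (simp only: lookup_scale mult_minus1)
      show ?thesis
      proof (cases "chain_tuple R (Suc m) c \<Gamma>")
        case True
        obtain i \<Gamma>' where i: "odd i" "1 \<le> i" "i \<le> length qs + 1" "\<Gamma> = take i d # \<Gamma>'"
          by (rule stuck_first_chain[OF st d_def lcd(2,1) True]) (auto intro: that)
        have t': "chain_tuple R m (drop i d) \<Gamma>'" using True tc[OF i(2,3)] i(4) by simp
        have "?t j = 0" if "j \<in> {1..length qs + 1} - {i}" for j
        proof -
          have "length (take j d) = j" "length (take i d) = i" using that i ld by auto
          then have "take i d \<noteq> take j d" using that by force
          then show ?thesis using i(4) by simp
        qed
        then have "(\<Sum>j\<in>{1..length qs + 1}. ?t j) = (\<Sum>j\<in>{i}. ?t j)"
          using i by (intro sum.mono_neutral_right) auto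
        also have "\<dots> = (-1) ^ (m - 1)"
          using i t' IH(1)[OF i(1,3)] by (simp add: power_mult)
        finally have "Poly_Mapping.lookup (transfer_h R (Suc m) c :: _ \<Rightarrow>\<^sub>0 'k) \<Gamma> = (-1) ^ m"
          using lk False by (cases m) auto
        moreover have "\<forall>\<gamma>\<in>set (butlast \<Gamma>). odd (length \<gamma>)"
          using IH(2)[OF i(1,3) t'] i ld by auto
        ultimately show ?thesis using True by simp
      next
        case nt: False
        have "?t i = 0" if "i \<in> {1..length qs + 1}" for i
        proof (cases "even i")
          case True
          then show ?thesis using even_0 that by simp
        next
          case odd: False
          show ?thesis
          proof (cases "\<Gamma> \<noteq> [] \<and> hd \<Gamma> = take i d")
            case True
            then have "\<Gamma> = take i d # tl \<Gamma>" by (metis list.collapse)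
            then have "\<not> chain_tuple R m (drop i d) (tl \<Gamma>)" using nt tc[of i "tl \<Gamma>"] that by auto
            then show ?thesis using IH(1)[of i "tl \<Gamma>"] odd that by simp
          qed auto
        qed
        then have "(\<Sum>i\<in>{1..length qs + 1}. ?t i) = 0" by (intro sum.neutral) blast
        then show ?thesis using lk nt by simp
      qed
    qed
  qed
qed

section \<open>Decompositions and signs\<close>

text \<open>An \<open>r\<close>-chain has \<open>r + 1\<close> bars, which turns the condition on the lengths into one on the numbers of bars.\<close>

lemma decomposition_iff:
  assumes "is_chain R \<gamma>"
  shows "decomposition R \<gamma> \<Gamma> \<longleftrightarrow> length \<Gamma> \<ge> 2 \<and> (\<forall>\<delta>\<in>set \<Gamma>. is_chain R \<delta>) \<and>
    concat (map concat \<Gamma>) = concat \<gamma> \<and> sum_list (map length \<Gamma>) + 2 = length \<gamma> + length \<Gamma>"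
proof -
  have lens: "list_all2 (chain R) rs \<Gamma> \<longleftrightarrow> (\<forall>\<delta>\<in>set \<Gamma>. is_chain R \<delta>) \<and> map length \<Gamma> = map Suc rs" for rs
    by (induction \<Gamma> arbitrary: rs) (auto simp: list_all2_Cons2 chain_iff_is_chain Cons_eq_map_conv)
  have sum: "sum_list (map Suc rs) = sum_list rs + length rs" for rs :: "nat list"
    by (induction rs) auto
  have ex: "\<exists>rs. map length \<Gamma> = map Suc rs" if "\<forall>\<delta>\<in>set \<Gamma>. is_chain R \<delta>"
    using that
  proof (induction \<Gamma>)
    case (Cons \<delta> \<Gamma>)
    then obtain rs where "map length \<Gamma> = map Suc rs" by auto
    moreover obtain k where "length \<delta> = Suc k" using is_chainD(4) Cons.prems by (cases \<delta>) fastforce+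
    ultimately have "map length (\<delta> # \<Gamma>) = map Suc (k # rs)" by simp
    then show ?case by blast
  qed simp
  have len: "length rs = length \<Gamma>" if "map length \<Gamma> = map Suc rs" for rs
    using that by (metis length_map)
  show ?thesis
  proof
    assume "decomposition R \<gamma> \<Gamma>"
    then obtain r rs where 1: "length \<Gamma> \<ge> 2" "length \<gamma> = r + 1" "\<forall>\<delta>\<in>set \<Gamma>. is_chain R \<delta>"
      "map length \<Gamma> = map Suc rs" "int (sum_list rs) = int r - 1" "concat (map concat \<Gamma>) = concat \<gamma>"
      unfolding decomposition_def lens by (auto simp: chain_iff_is_chain)
    then show "length \<Gamma> \<ge> 2 \<and> (\<forall>\<delta>\<in>set \<Gamma>. is_chain R \<delta>) \<and>
        concat (map concat \<Gamma>) = concat \<gamma> \<and> sum_list (map length \<Gamma>) + 2 = length \<gamma> + length \<Gamma>"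
      using len[OF 1(4)] by (simp only: sum) simp
  next
    assume 2: "length \<Gamma> \<ge> 2 \<and> (\<forall>\<delta>\<in>set \<Gamma>. is_chain R \<delta>) \<and>
      concat (map concat \<Gamma>) = concat \<gamma> \<and> sum_list (map length \<Gamma>) + 2 = length \<gamma> + length \<Gamma>"
    then obtain rs where rs: "map length \<Gamma> = map Suc rs" using ex by blast
    have lg: "length \<gamma> = (length \<gamma> - 1) + 1" using is_chainD(4)[OF assms] by (cases \<gamma>) auto
    have "sum_list rs + length \<Gamma> + 2 = length \<gamma> + length \<Gamma>"
      using 2 len[OF rs] unfolding rs sum by simp
    then have "int (sum_list rs) = int (length \<gamma> - 1) - 1" by simp
    then show "decomposition R \<gamma> \<Gamma>"
      unfolding decomposition_def lens using 2 rs lg assms by (auto simp: chain_iff_is_chain)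
  qed
qed

text \<open>The chain \<open>\<gamma>\<close> itself is split without a preceding \<open>h\<close>, so its first part may have any number of bars,
which is why \<open>length (hd \<Gamma>)\<close> remains in the exponent.\<close>

lemma lookup_Delta:
  fixes R :: "'x list set"
  assumes \<gamma>: "is_chain R \<gamma>" and n: "n \<ge> 2"
  shows "Poly_Mapping.lookup (Delta R n \<gamma> :: _ \<Rightarrow>\<^sub>0 'k::field) \<Gamma> =
      (if length \<Gamma> = n \<and> decomposition R \<gamma> \<Gamma> then (-1) ^ (n * (length (hd \<Gamma>) + 1) + n) else 0)
    \<and> (length \<Gamma> = n \<and> decomposition R \<gamma> \<Gamma> \<longrightarrow> (\<forall>\<delta>\<in>set (butlast (tl \<Gamma>)). odd (length \<delta>)))"
proof -
  let ?t = "\<lambda>i. if \<Gamma> \<noteq> [] \<and> hd \<Gamma> = take i \<gamma> then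
      (-1) ^ (n * (i + 1)) * Poly_Mapping.lookup (transfer_h R (n - 1) (drop i \<gamma>) :: _ \<Rightarrow>\<^sub>0 'k) (tl \<Gamma>) else 0"
  have lk: "Poly_Mapping.lookup (Delta R n \<gamma> :: _ \<Rightarrow>\<^sub>0 'k) \<Gamma> = (\<Sum>i\<in>{1..<length \<gamma>}. ?t i)"
    unfolding Delta_eq_transfer transfer_chain[OF assms]
    by (simp only: lookup_sum lookup_scale lookup_tens_single if_distrib[of "(*) _"] mult_zero_right)
  have gd: "interlaced R (drop i \<gamma>)" "bar_term R (drop i \<gamma>)" if "i < length \<gamma>" for i
  proof -
    show bt: "bar_term R (drop i \<gamma>)" using bar_term_drop[OF is_chainD(1)[OF \<gamma>] that] .
    then have "drop i \<gamma> \<noteq> []" "hd (drop i \<gamma>) \<noteq> []" by (auto simp: bar_term_def)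
    then show "interlaced R (drop i \<gamma>)" using successively_interlaced successively_drop is_chainD(3)[OF \<gamma>] by blast
  qed
  have th: "Poly_Mapping.lookup (transfer_h R (n - 1) (drop i \<gamma>) :: _ \<Rightarrow>\<^sub>0 'k) \<Gamma>' =
        (if chain_tuple R (n - 1) (drop i \<gamma>) \<Gamma>' then (-1) ^ n else 0)"
      "chain_tuple R (n - 1) (drop i \<gamma>) \<Gamma>' \<Longrightarrow> \<forall>\<delta>\<in>set (butlast \<Gamma>'). odd (length \<delta>)"
    if "i < length \<gamma>" for i \<Gamma>'
  proof -
    have m: "n - 1 \<ge> 1" using n by linarith
    have "(-1) ^ (n - 1 - 1) = ((-1) ^ n :: 'k)" using n by (cases n; cases "n - 1") auto
    then show "Poly_Mapping.lookup (transfer_h R (n - 1) (drop i \<gamma>) :: _ \<Rightarrow>\<^sub>0 'k) \<Gamma>' =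
        (if chain_tuple R (n - 1) (drop i \<gamma>) \<Gamma>' then (-1) ^ n else 0)"
      using lookup_transfer_h_interlaced[OF m gd[OF that], of \<Gamma>', where 'k='k] by presburger
    show "chain_tuple R (n - 1) (drop i \<gamma>) \<Gamma>' \<Longrightarrow> \<forall>\<delta>\<in>set (butlast \<Gamma>'). odd (length \<delta>)"
      using lookup_transfer_h_interlaced[OF m gd[OF that], of \<Gamma>', where 'k='k] by blast
  qed
  have dec: "length (take i \<gamma> # \<Gamma>') = n \<and> decomposition R \<gamma> (take i \<gamma> # \<Gamma>') \<longleftrightarrow> chain_tuple R (n - 1) (drop i \<gamma>) \<Gamma>'"
    if "1 \<le> i" "i < length \<gamma>" for i \<Gamma>'
  proof -
    have "is_chain R (take i \<gamma>)"
      using \<gamma> that is_chain_prefix[of R "take i \<gamma>" "drop i \<gamma>"] by fastforce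
    moreover have "concat \<gamma> = concat (take i \<gamma>) @ concat (drop i \<gamma>)"
      by (metis append_take_drop_id concat_append)
    ultimately show ?thesis using that n unfolding decomposition_iff[OF \<gamma>] chain_tuple_def by auto
  qed
  show ?thesis
  proof (cases "length \<Gamma> = n \<and> decomposition R \<gamma> \<Gamma>")
    case True
    then obtain \<delta> \<Gamma>' where \<Gamma>: "\<Gamma> = \<delta> # \<Gamma>'" using n by (cases \<Gamma>) auto
    from True have D: "\<forall>\<delta>\<in>set \<Gamma>. is_chain R \<delta>" "concat (map concat \<Gamma>) = concat \<gamma>"
      using decomposition_iff[OF \<gamma>] by auto
    obtain \<epsilon> \<Gamma>'' where "\<Gamma>' = \<epsilon> # \<Gamma>''" using True n \<Gamma> by (cases \<Gamma>') auto
    moreover from this have "is_chain R \<epsilon>" using D(1) \<Gamma> by simp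
    from concat_nonempty[OF is_chainD(1)[OF this]] have "concat \<epsilon> \<noteq> []" .
    ultimately have ne: "concat (map concat \<Gamma>') \<noteq> []" by simp
    have eq: "concat \<delta> @ concat (map concat \<Gamma>') = concat \<gamma> @ []" using D(2) \<Gamma> by simp
    have "prefix \<delta> \<gamma>" using is_chain_comparable[OF _ \<gamma> eq] D(1) \<Gamma> eq ne by (auto simp: prefix_def)
    moreover have "\<delta> \<noteq> \<gamma>" using eq ne by auto
    moreover have "\<delta> \<noteq> []" using D(1) \<Gamma> is_chainD(4) by auto
    moreover define i where "i = length \<delta>"
    ultimately have i: "1 \<le> i" "i < length \<gamma>" "\<delta> = take i \<gamma>"
      using prefix_length_less[of \<delta> \<gamma>] by (auto simp: strict_prefix_def prefix_def Suc_le_eq)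
    have t: "chain_tuple R (n - 1) (drop i \<gamma>) \<Gamma>'" using dec[OF i(1,2)] True \<Gamma> i(3) by simp
    have "?t j = 0" if "j \<in> {1..<length \<gamma>} - {i}" for j
    proof -
      have "length (take j \<gamma>) = j" "length \<delta> = i" using that by (auto simp: i_def)
      then have "\<delta> \<noteq> take j \<gamma>" using that by force
      then show ?thesis using \<Gamma> by simp
    qed
    then have "(\<Sum>j\<in>{1..<length \<gamma>}. ?t j) = (\<Sum>j\<in>{i}. ?t j)"
      using i by (intro sum.mono_neutral_right) auto
    also have "\<dots> = (-1) ^ (n * (i + 1)) * (-1) ^ n" using \<Gamma> i(3) th(1)[OF i(2)] t by simp
    also have "\<dots> = (-1) ^ (n * (i + 1) + n)" by (rule power_add[symmetric])
    finally show ?thesis using lk True th(2)[OF i(2) t] \<Gamma> by (simp add: i_def)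
  next
    case False
    have "?t i = 0" if i: "i \<in> {1..<length \<gamma>}" for i
    proof (cases "\<Gamma> \<noteq> [] \<and> hd \<Gamma> = take i \<gamma>")
      case True
      then have "\<Gamma> = take i \<gamma> # tl \<Gamma>" by (metis list.collapse)
      then have "\<not> chain_tuple R (n - 1) (drop i \<gamma>) (tl \<Gamma>)" using False dec[of i "tl \<Gamma>"] i by auto
      then show ?thesis using th(1)[of i "tl \<Gamma>"] i by simp
    qed auto
    then have "(\<Sum>i\<in>{1..<length \<gamma>}. ?t i) = 0" by (intro sum.neutral) blast
    then show ?thesis using lk False by auto
  qed
qed

lemma sum_rev_choose_two: "(\<Sum>i=1..k. Suc k - i) = (Suc k choose 2)"
proof -
  have "(\<Sum>i=1..k. Suc k - i) = (\<Sum>i=1..k. i)"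
    by (subst sum.atLeastAtMost_rev) (auto intro!: sum.cong)
  then show ?thesis by (simp add: Sum_Icc_nat choose_two algebra_simps)
qed

text \<open>For \<open>1 < i < n\<close> the factor \<open>r i + 1\<close> is odd and can be omitted modulo \<open>2\<close>; then the identities
\<open>(n + 1 choose 2) = n + (n choose 2)\<close> and \<open>(n choose 2) = (n - 1) + \<dots> + 1\<close> make everything cancel except
\<open>n r\<^sub>1 + n\<close>.\<close>

lemma sign_parity:
  assumes n: "n \<ge> 2" and odd: "\<And>i. i \<in> {2..n - 1} \<Longrightarrow> odd (r i + 1)"
  shows "even ((n + 1 choose 2) + r 1 + (\<Sum>i=1..n-1. (n - i) * (r i + 1))) \<longleftrightarrow> even (n * (r 1 + 2) + n)"
proof -
  have split: "(\<Sum>i=1..n-1. f i) = f 1 + (\<Sum>i=2..n-1. f i)" for f :: "nat \<Rightarrow> nat"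
    using n by (subst sum.atLeast_Suc_atMost) (auto simp: numeral_2_eq_2)
  have tail: "even (\<Sum>i=2..n-1. (n - i) * (r i + 1)) \<longleftrightarrow> even (\<Sum>i=2..n-1. n - i)"
    unfolding even_sum_iff[OF finite_atLeastAtMost]
    by (rule arg_cong[of _ _ "\<lambda>S. even (card S)"]) (use odd in auto)
  have "(\<Sum>i=1..n-1. n - i) = (n choose 2)"
    using sum_rev_choose_two[of "n - 1"] n by simp
  then have "(n choose 2) = (n - 1) + (\<Sum>i=2..n-1. n - i)" using split[of "\<lambda>i. n - i"] by simp
  then have choose: "even (n choose 2) \<longleftrightarrow> (even (n - 1) \<longleftrightarrow> even (\<Sum>i=2..n-1. n - i))"
    by (simp only: even_add)
  have choose': "(n + 1 choose 2) = n + (n choose 2)" by (simp add: numeral_2_eq_2)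
  have "even n \<longleftrightarrow> odd (n - 1)" using n by simp
  then show ?thesis
    unfolding split[of "\<lambda>i. (n - i) * (r i + 1)"] choose' even_add even_mult_iff tail choose by auto
qed

theorem theorem4p1:
  fixes R :: "'x::finite list set" and \<gamma> :: "'x list list" and m n :: nat
  assumes "monomial_relations R" and "chain R m \<gamma>" and "n \<ge> 2"
  shows "{\<gamma>s. Poly_Mapping.lookup (Delta R n \<gamma> :: 'x list list list \<Rightarrow>\<^sub>0 'k::field) \<gamma>s \<noteq> 0}
           = {\<gamma>s. length \<gamma>s = n \<and> decomposition R \<gamma> \<gamma>s}
       \<and> (\<forall>\<gamma>s r. length \<gamma>s = n \<and> decomposition R \<gamma> \<gamma>s \<and>
                 (\<forall>i\<in>{1..n}. chain R (r i) (\<gamma>s ! (i - 1))) \<longrightarrow>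
            Poly_Mapping.lookup (Delta R n \<gamma> :: 'x list list list \<Rightarrow>\<^sub>0 'k) \<gamma>s
              = (-1) ^ ((n + 1 choose 2) + r 1 + (\<Sum>i=1..n-1. (n - i) * (r i + 1))))"
proof (intro conjI allI impI)
  have \<gamma>: "is_chain R \<gamma>" using assms(2) by (simp add: chain_iff_is_chain)
  note lookup = lookup_Delta[OF \<gamma> assms(3), where 'k = 'k]
  show "{\<gamma>s. Poly_Mapping.lookup (Delta R n \<gamma> :: 'x list list list \<Rightarrow>\<^sub>0 'k::field) \<gamma>s \<noteq> 0}
           = {\<gamma>s. length \<gamma>s = n \<and> decomposition R \<gamma> \<gamma>s}"
    using lookup by simp
  fix \<gamma>s :: "'x list list list" and r :: "nat \<Rightarrow> nat"
  assume *: "length \<gamma>s = n \<and> decomposition R \<gamma> \<gamma>s \<and> (\<forall>i\<in>{1..n}. chain R (r i) (\<gamma>s ! (i - 1)))"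
  then have len: "r i + 1 = length (\<gamma>s ! (i - 1))" if "i \<in> {1..n}" for i
    using that by (simp add: chain_iff_is_chain)
  have odd: "odd (r i + 1)" if "i \<in> {2..n - 1}" for i
  proof -
    have "butlast (tl \<gamma>s) ! (i - 2) = \<gamma>s ! (i - 1)" "i - 2 < length (butlast (tl \<gamma>s))"
      using that * by (auto simp: nth_butlast nth_tl Suc_diff_Suc numeral_2_eq_2)
    then have "\<gamma>s ! (i - 1) \<in> set (butlast (tl \<gamma>s))" by (metis nth_mem)
    moreover have "i \<in> {1..n}" using that by auto
    ultimately show ?thesis using lookup[of \<gamma>s] * by (simp only: len) blast
  qed
  have "\<gamma>s \<noteq> []" using * assms(3) by auto
  then have "length (hd \<gamma>s) + 1 = r 1 + 2" using len[of 1] assms(3) by (simp add: hd_conv_nth)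
  then have "Poly_Mapping.lookup (Delta R n \<gamma> :: _ \<Rightarrow>\<^sub>0 'k) \<gamma>s = (-1) ^ (n * (r 1 + 2) + n)"
    using lookup[of \<gamma>s] * by presburger
  then show "Poly_Mapping.lookup (Delta R n \<gamma> :: 'x list list list \<Rightarrow>\<^sub>0 'k) \<gamma>s
              = (-1) ^ ((n + 1 choose 2) + r 1 + (\<Sum>i=1..n-1. (n - i) * (r i + 1)))"
    using sign_parity[of n r, OF assms(3) odd] by (simp only: minus_one_power_iff)
qed

end
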